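(* Let $(\tau_n)_{n\in\mathbb{N}}$ be the Thue–Morse sequence and $\tau(t)=\sum_{n=1}^\infty\tau_nt^{-n}\in\mathbb{F}_2(\!(t^{-1})\!)$. Then $\tau(t)$ exhibits full generic escape of mass with respect to $\{t^k\}_{k\ge0}$; that is, for every $\varepsilon>0$, $\lim_{n\to\infty}d(\{k\in\mathbb{N}:e_{k,n}(\tau(t))>1-\varepsilon\})=1$.
   Context: The Thue–Morse sequence over $\mathbb{F}_2$ is the fixed point $0110100110010110\cdots$ of the substitution $0\mapsto01$, $1\mapsto10$; $\tau(t)$ is a quadratic irrational. For a quadratic irrational $\Theta$, $e_{k,n}(\Theta):=\frac{\sum_{i=1}^{\ell_{k}}\max\{\deg A_i^{[\Theta t^k]}-n,0\}}{\sum_{i=1}^{\ell_{k}}\deg A_i^{[\Theta t^k]}}$, where $\ell_k$ is the period length of the eventually periodic continued fraction of $\Theta\cdot t^k$ and $A_1^{[\Theta t^k]},\dots,A_{\ell_k}^{[\Theta t^k]}$ are the partial quotients of one period. For $A\subseteq\mathbb{N}$, $d(A)=\lim_{m\to\infty}\frac{|A\cap\{1,\dots,m\}|}{m}$. *)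

theory Defs
  imports "HOL-Computational_Algebra.Formal_Laurent_Series" "HOL-Library.Z2"
begin

text \<open>We model F_2((t^{-1})) as the field of formal Laurent series bit fls in the
  variable X = t^{-1}; thus the coefficient x $$ j is the coefficient of t^{-j},
  and the series have only finitely many positive powers of t.\<close>

text \<open>Thue--Morse sequence 0110100110010110..., the fixed point of 0->01, 1->10,
  indexed from 0: tm (2m) = tm m, tm (2m+1) = 1 - tm m.\<close>
function tm :: "nat \<Rightarrow> bit" where
  "tm n = (if n = 0 then 0 else if even n then tm (n div 2) else 1 - tm (n div 2))"
  by auto
termination by (relation "measure id") auto

text \<open>tau_n for n >= 1 is the n-th letter of the word 0110..., i.e. tau_n = tm (n-1),
  and tau(t) = sum_{n>=1} tau_n t^{-n}.\<close>
definition thue_morse_series :: "bit fls" where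
  "thue_morse_series = fps_to_fls (Abs_fps (\<lambda>n. if n = 0 then 0 else tm (n - 1)))"

definition tvar :: "bit fls" where
  "tvar = fls_X_inv"

text \<open>Polynomial part (partial quotient) of x, as a polynomial in t:
  its coefficient of t^j is the coefficient x $$ (-j).\<close>
definition cf_poly_part :: "bit fls \<Rightarrow> bit poly" where
  "cf_poly_part x = fls_prpart x + pCons (fls_nth x 0) 0"

definition cf_frac_part :: "bit fls \<Rightarrow> bit fls" where
  "cf_frac_part x = fps_to_fls (fls_regpart x) - fls_const (fls_nth x 0)"

fun cf_state :: "bit fls \<Rightarrow> nat \<Rightarrow> bit fls" where
  "cf_state \<Theta> 0 = \<Theta>"
| "cf_state \<Theta> (Suc i) = inverse (cf_frac_part (cf_state \<Theta> i))"

definition cf_pq :: "bit fls \<Rightarrow> nat \<Rightarrow> bit poly" where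
  "cf_pq \<Theta> i = cf_poly_part (cf_state \<Theta> i)"

definition cf_period :: "bit fls \<Rightarrow> nat" where
  "cf_period \<Theta> = (LEAST l. 0 < l \<and> (\<exists>N. \<forall>i\<ge>N. cf_pq \<Theta> (i + l) = cf_pq \<Theta> i))"

definition cf_preperiod :: "bit fls \<Rightarrow> nat" where
  "cf_preperiod \<Theta> = (LEAST N. \<forall>i\<ge>N. cf_pq \<Theta> (i + cf_period \<Theta>) = cf_pq \<Theta> i)"

definition cf_period_indices :: "bit fls \<Rightarrow> nat set" where
  "cf_period_indices \<Theta> = {cf_preperiod \<Theta> ..< cf_preperiod \<Theta> + cf_period \<Theta>}"

text \<open>e_{k,n}(Theta); note that nat subtraction gives max{deg A - n, 0}.\<close>
definition escape_ratio :: "bit fls \<Rightarrow> nat \<Rightarrow> nat \<Rightarrow> real" where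
  "escape_ratio \<Theta> k n =
     (let x = \<Theta> * tvar ^ k in
      (\<Sum>i\<in>cf_period_indices x. real (degree (cf_pq x i) - n)) /
      (\<Sum>i\<in>cf_period_indices x. real (degree (cf_pq x i))))"

definition has_density :: "nat set \<Rightarrow> real \<Rightarrow> bool" where
  "has_density A \<delta> \<longleftrightarrow> ((\<lambda>m. real (card (A \<inter> {1..m})) / real m) \<longlonglongrightarrow> \<delta>)"

end

theory Submission
  imports Defs
begin

text \<open>Put \<open>u = t + 1\<close> and \<open>s = u \<tau>\<close>; then \<open>s\<^sup>2 + s = 1/u\<close>. Call \<open>(k, N)\<close> vanishing for \<open>x\<close> if some nonzero
  \<open>Q\<close> with \<open>deg Q < N\<close> makes the distance of \<open>Q t\<^sup>k x\<close> to the polynomials smaller than \<open>|t|\<^sup>-\<^sup>N\<close>; the degrees of the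
  convergent denominators of \<open>t\<^sup>k x\<close> are among the \<open>N\<close> with \<open>(k, N)\<close> not vanishing. Over \<open>F\<^sub>2\<close> every cross
  of five neighbouring points contains a vanishing one, for any \<open>x\<close>. For \<open>x = s\<close>, the equation gives
  \<open>s\<^sup>n = s + R/u\<^sup>n\<^sup>/\<^sup>2\<close> with a polynomial \<open>R\<close> for every power \<open>n > 1\<close> of 2, so the \<open>n\<close>-th power of an
  approximation at \<open>(k, N)\<close> yields a window of vanishing points around \<open>(nk, nN)\<close> of size proportional
  to \<open>n\<close>; the same holds for \<open>\<tau>\<close>. Hence the nonvanishing points form a porous set: in each box of side
  \<open>16\<^sup>j\<close> there are at most \<open>255\<^sup>j\<close> of the \<open>256\<^sup>j\<close> points. Therefore, for all \<open>k\<close> outside a set of density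
  0, the number of partial quotients in a period of \<open>t\<^sup>k \<tau>\<close> is a small fraction of their total degree,
  and then lowering each degree by \<open>n\<close> loses little mass.\<close>

unbundle fps_syntax

subsection \<open>Laurent series over the field with two elements\<close>

lemma bit_add_self: "(a :: bit) + a = 0"
  by (cases a) simp_all

lemma fls_add_self: "(x :: bit fls) + x = 0"
  by (rule fls_eqI) (simp only: fls_plus_nth bit_add_self fls_zero_nth)

lemma fls_minus_eq_plus: "(x :: bit fls) - y = x + y"
proof -
  have "x - y = x - y + (y + y)" by (subst fls_add_self) (rule add_0_right[symmetric])
  also have "\<dots> = x + y" by (simp only: diff_add_cancel add.assoc[symmetric])
  finally show ?thesis .
qed

lemma fls_eq_iff_add_eq_0: "(x :: bit fls) = y \<longleftrightarrow> x + y = 0"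
  unfolding fls_minus_eq_plus[symmetric] by (rule eq_iff_diff_eq_0)

lemma fls_square_add: "((x :: bit fls) + y)\<^sup>2 = x\<^sup>2 + y\<^sup>2"
proof -
  have "(x + y)\<^sup>2 = x\<^sup>2 + y\<^sup>2 + (x * y + x * y)"
    by (simp add: power2_eq_square algebra_simps)
  then show ?thesis by (simp add: fls_add_self)
qed

lemma fls_frobenius_add: "((x :: bit fls) + y) ^ (2 ^ i) = x ^ (2 ^ i) + y ^ (2 ^ i)"
proof (induction i)
  case (Suc i)
  then show ?case
    by (simp add: power_mult mult.commute[of 2] fls_square_add)
qed simp

text \<open>The variable is \<open>X = t\<^sup>-\<^sup>1\<close>, so degrees in \<open>t\<close> are negated subdegrees and polynomials
  in \<open>t\<close> are the series without positive powers of \<open>X\<close>.\<close>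

definition deg_le :: "'a::zero fls \<Rightarrow> int \<Rightarrow> bool" where
  "deg_le x d \<longleftrightarrow> (\<forall>n. n < -d \<longrightarrow> x $$ n = 0)"

definition polyn :: "'a::zero fls \<Rightarrow> bool" where
  "polyn x \<longleftrightarrow> (\<forall>n>0. x $$ n = 0)"

lemma deg_le_0 [simp]: "deg_le 0 d"
  by (simp add: deg_le_def)

lemma deg_le_iff: "deg_le x d \<longleftrightarrow> x = 0 \<or> - d \<le> fls_subdegree x"
proof
  assume "deg_le x d"
  then show "x = 0 \<or> - d \<le> fls_subdegree x"
    unfolding deg_le_def by (metis fls_subdegree_geI)
next
  assume *: "x = 0 \<or> - d \<le> fls_subdegree x"
  show "deg_le x d"
    unfolding deg_le_def
  proof (intro allI impI)
    fix n assume "n < - d"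
    with * have "x = 0 \<or> n < fls_subdegree x" by linarith
    then show "x $$ n = 0" by (metis fls_eq0_below_subdegree fls_zero_nth)
  qed
qed

lemma deg_le_mono: "deg_le x d \<Longrightarrow> d \<le> e \<Longrightarrow> deg_le x e"
  by (auto simp: deg_le_def)

lemma deg_le_add: "deg_le x d \<Longrightarrow> deg_le y d \<Longrightarrow> deg_le (x + y) d" for x :: "'a::monoid_add fls"
  by (auto simp: deg_le_def)

lemma deg_le_mult: "deg_le x d \<Longrightarrow> deg_le y e \<Longrightarrow> deg_le (x * y) (d + e)" for x :: "'a::idom fls"
  by (cases "x = 0 \<or> y = 0") (auto simp: deg_le_iff)

lemma deg_le_1: "0 \<le> d \<Longrightarrow> deg_le 1 d"
  by (auto simp: deg_le_def)

lemma deg_le_power: "deg_le x d \<Longrightarrow> deg_le (x ^ n) (int n * d)" for x :: "'a::idom fls"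
proof (induction n)
  case (Suc n)
  then have "deg_le (x * x ^ n) (d + int n * d)"
    by (intro deg_le_mult) auto
  then show ?case by (simp add: algebra_simps)
qed (simp add: deg_le_1)

lemma deg_le_dec: "deg_le x d \<Longrightarrow> x $$ (- d) = 0 \<Longrightarrow> deg_le x (d - 1)"
  unfolding deg_le_def by (metis minus_diff_eq uminus_add_conv_diff zle_add1_eq_le order_le_less)

lemma deg_le_exact:
  fixes x :: "bit fls"
  assumes "deg_le x d" "\<not> deg_le x (d - 1)"
  shows "x $$ (- d) = 1"
  using assms deg_le_dec[of x d] by (cases "x $$ (- d)") simp_all

lemma ex_deg_le: "\<exists>d. deg_le x d"
  unfolding deg_le_iff by (metis add.inverse_inverse order_refl)

lemma polyn_0 [simp]: "polyn 0" and polyn_1 [simp]: "polyn 1"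
  by (auto simp: polyn_def)

lemma polyn_add: "polyn x \<Longrightarrow> polyn y \<Longrightarrow> polyn (x + y)" for x :: "'a::monoid_add fls"
  by (auto simp: polyn_def)

lemma polyn_mult:
  fixes x y :: "'a::semiring_0 fls"
  assumes x: "polyn x" and y: "polyn y"
  shows "polyn (x * y)"
  unfolding polyn_def
proof (intro allI impI)
  fix n :: int assume "0 < n"
  have "x $$ i * y $$ (n - i) = 0" for i
  proof (cases "i > 0")
    case True
    then have "x $$ i = 0" using x unfolding polyn_def by blast
    then show ?thesis by (rule ssubst) (rule mult_zero_left)
  next
    case False
    then have "n - i > 0" using \<open>0 < n\<close> by linarith
    then have "y $$ (n - i) = 0" using y unfolding polyn_def by blast
    then show ?thesis by (rule ssubst) (rule mult_zero_right)
  qed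
  then show "(x * y) $$ n = 0"
    unfolding fls_times_nth(2) by (intro sum.neutral ballI)
qed

lemma polyn_power: "polyn x \<Longrightarrow> polyn (x ^ n)" for x :: "'a::semiring_1 fls"
  by (induction n) (auto intro: polyn_mult)

lemma polyn_sum: "(\<And>i. i \<in> I \<Longrightarrow> polyn (f i)) \<Longrightarrow> polyn (sum f I)" for f :: "'b \<Rightarrow> 'a::comm_monoid_add fls"
  by (induction I rule: infinite_finite_induct) (auto intro: polyn_add)

lemma polyn_deg_neg: "polyn x \<Longrightarrow> deg_le x d \<Longrightarrow> d < 0 \<Longrightarrow> x = 0"
  unfolding polyn_def deg_le_def
proof (intro fls_eqI)
  fix n assume *: "\<forall>n>0. x $$ n = 0" "\<forall>n< -d. x $$ n = 0" "d < 0"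
  have "n > 0 \<or> n < -d" using \<open>d < 0\<close> by linarith
  then show "x $$ n = 0 $$ n" using * by (metis fls_zero_nth)
qed

text \<open>A polynomial over the two-element field is determined by its support, here a subset of
  \<open>{-d..0}\<close>. The pigeonhole argument for periodicity rests on this.\<close>

lemma finite_polyn_deg_le: "finite {x :: bit fls. polyn x \<and> deg_le x d}"
proof -
  have "inj_on (\<lambda>x :: bit fls. {n. x $$ n = 1}) {x. polyn x \<and> deg_le x d}"
  proof (rule inj_onI, rule fls_eqI)
    fix x y :: "bit fls" and n
    assume "{n. x $$ n = 1} = {n. y $$ n = 1}"
    then have "x $$ n = 1 \<longleftrightarrow> y $$ n = 1"
      by blast
    then show "x $$ n = y $$ n"
      by (cases "x $$ n"; cases "y $$ n") simp_all
  qed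
  moreover have "(\<lambda>x :: bit fls. {n. x $$ n = 1}) ` {x. polyn x \<and> deg_le x d} \<subseteq> Pow {-d..0}"
  proof (clarsimp simp: polyn_def deg_le_def)
    fix x :: "bit fls" and n assume *: "\<forall>n>0. x $$ n = 0" "\<forall>n< -d. x $$ n = 0" "x $$ n = 1"
    have "\<not> n > 0" "\<not> n < -d"
      using * by (metis zero_neq_one)+
    then show "- d \<le> n \<and> n \<le> 0" by simp
  qed
  then have "finite ((\<lambda>x :: bit fls. {n. x $$ n = 1}) ` {x. polyn x \<and> deg_le x d})"
    by (rule finite_subset) simp
  ultimately show ?thesis
    by (rule finite_imageD[rotated])
qed

lemma tvar_times_nth [simp]: "(tvar * x) $$ n = x $$ (n + 1)"
  by (simp add: tvar_def fls_X_inv_times_conv_shift)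

lemma tvar_nonzero [simp]: "tvar \<noteq> 0"
  by (simp add: tvar_def)

lemma polyn_tvar [simp]: "polyn tvar"
  by (auto simp: polyn_def tvar_def)

lemma deg_le_tvar: "deg_le tvar 1"
  by (auto simp: deg_le_def tvar_def)

lemma deg_le_tvar_timesD:
  assumes "deg_le (tvar * x) d"
  shows "deg_le x (d - 1)"
  unfolding deg_le_def
proof (intro allI impI)
  fix n assume "n < - (d - 1)"
  then have "n - 1 < - d" by linarith
  then have "(tvar * x) $$ (n - 1) = 0"
    using assms unfolding deg_le_def by blast
  then show "x $$ n = 0" by simp
qed

lemma polyn_divide_tvar:
  assumes "polyn x" "x $$ 0 = 0"
  obtains y where "polyn y" "x = tvar * y"
proof
  show "x = tvar * (fls_X * x)"
    by (rule fls_eqI) (simp only: tvar_times_nth fls_X_times_conv_shift fls_shift_nth, simp)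
  show "polyn (fls_X * x)"
    unfolding polyn_def
  proof (intro allI impI)
    fix n :: int assume "0 < n"
    then have "n - 1 = 0 \<or> 0 < n - 1" by linarith
    then have "x $$ (n - 1) = 0" using assms unfolding polyn_def by metis
    then show "(fls_X * x) $$ n = 0"
      by (simp only: fls_X_times_conv_shift fls_shift_nth diff_conv_add_uminus)
  qed
qed

subsection \<open>The Artin--Schreier equation\<close>

text \<open>The terms for \<open>i\<close> and \<open>n - i\<close> cancel in characteristic 2; only
  the middle term \<open>2 * i = n\<close> survives.\<close>

lemma fps_square_nth_bit:
  "(f\<^sup>2) $ n = (if even n then f $ (n div 2) else 0)" for f :: "bit fps"
proof -
  let ?g = "\<lambda>i. f $ i * f $ (n - i)"
  let ?L = "{i. 2 * i < n}" and ?G = "{i. i \<le> n \<and> n < 2 * i}" and ?M = "{i. 2 * i = n}"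
  have fin: "finite ?L" "finite ?G" "finite ?M"
    by (rule finite_subset[of _ "{..n}"]; force)+
  have "sum ?g ?G = sum ?g ?L"
    by (rule sum.reindex_bij_witness[of _ "\<lambda>i. n - i" "\<lambda>i. n - i"]) (auto simp: mult.commute simp del: mult_bit_eq_and)
  then have "sum ?g ?L + sum ?g ?G = 0"
    by (simp only: bit_add_self)
  moreover have "{0..n} = (?L \<union> ?G) \<union> ?M"
    by auto
  then have "sum ?g {0..n} = sum ?g ?L + sum ?g ?G + sum ?g ?M"
    using fin by (simp only:) (subst sum.union_disjoint; (subst sum.union_disjoint)?; force)
  ultimately have "sum ?g {0..n} = sum ?g ?M"
    by (simp only: add_0)
  also have "\<dots> = (if even n then f $ (n div 2) else 0)"
  proof (cases "even n")
    case True
    then have "?M = {n div 2}" and "n - n div 2 = n div 2" by auto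
    then show ?thesis using True by (cases "f $ (n div 2)") simp_all
  next
    case False
    then have "?M = {}" by auto
    then show ?thesis using False by (simp only: sum.empty if_False)
  qed
  finally show ?thesis
    by (simp only: power2_eq_square fps_mult_nth)
qed

lemma tm_even: "even n \<Longrightarrow> tm n = tm (n div 2)"
  by (subst tm.simps) (auto simp: tm.simps[of 0] simp del: tm.simps)

lemma tm_odd: "odd n \<Longrightarrow> tm n = tm (n div 2) + 1"
  by (subst tm.simps) (auto simp: add.commute simp del: tm.simps add_bit_eq_xor)

declare tm.simps [simp del]

text \<open>The rules for even and odd indices merge into one functional equation:
  \<open>(1 + fps_X) * T\<^sup>2\<close> puts \<open>tm m\<close> at both \<open>2m\<close> and
  \<open>2m + 1\<close>, and \<open>E\<close>, which equals \<open>X / (1 + X)^2\<close>, adds 1 at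
  the odd positions.\<close>

lemma tm_fps_eq:
  defines "T \<equiv> Abs_fps tm" and "E \<equiv> Abs_fps (\<lambda>n. if odd n then 1 else 0)"
  shows "T = (1 + fps_X) * T\<^sup>2 + E" and "(1 + fps_X)\<^sup>2 * E = fps_X"
proof -
  show "T = (1 + fps_X) * T\<^sup>2 + E"
  proof (rule fps_ext)
    fix n
    have "((1 + fps_X) * T\<^sup>2 + E) $ n =
        T\<^sup>2 $ n + (if n = 0 then 0 else T\<^sup>2 $ (n - 1)) + E $ n"
      by (simp only: distrib_right mult_1 fps_add_nth fps_X_mult_nth)
    also have "\<dots> = T $ n"
    proof (cases "even n")
      case True
      then show ?thesis
        by (auto simp: fps_square_nth_bit T_def E_def tm_even[of n] simp del: add_bit_eq_xor)
    next
      case False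
      then have "n \<noteq> 0" "even (n - 1)" "(n - 1) div 2 = n div 2" by (auto elim: oddE)
      then show ?thesis using False
        by (simp add: fps_square_nth_bit T_def E_def tm_odd[of n] del: add_bit_eq_xor)
    qed
    finally show "T $ n = ((1 + fps_X) * T\<^sup>2 + E) $ n" ..
  qed
  have "(1 + fps_X :: bit fps)\<^sup>2 = 1 + fps_X\<^sup>2"
    by (rule fps_ext) (simp add: fps_square_nth_bit del: add_bit_eq_xor, presburger)
  moreover have "(1 + fps_X\<^sup>2) * E = fps_X"
  proof (rule fps_ext)
    fix n
    have "((1 + fps_X\<^sup>2) * E) $ n = E $ n + (if n < 2 then 0 else E $ (n - 2))"
      by (simp only: distrib_right mult_1 fps_add_nth fps_X_power_mult_nth)
    also have "\<dots> = fps_X $ n"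
    proof (cases "n < 2")
      case True
      then have "n = 0 \<or> n = 1" by linarith
      then show ?thesis by (auto simp: E_def simp del: add_bit_eq_xor)
    next
      case False
      then show ?thesis by (auto simp: E_def bit_add_self simp del: add_bit_eq_xor)
    qed
    finally show "((1 + fps_X\<^sup>2) * E) $ n = fps_X $ n" .
  qed
  ultimately show "(1 + fps_X)\<^sup>2 * E = fps_X" by (simp only:)
qed

definition uvar :: "bit fls" where
  "uvar = tvar + 1"

lemma uvar_eq: "uvar = fls_X_inv * fps_to_fls (1 + fps_X)"
  by (rule fls_eqI) (auto simp: uvar_def tvar_def fls_X_inv_times_conv_shift simp del: add_bit_eq_xor)

text \<open>The factor u makes the two upper coefficients of the quadratic equation equal:
  \<open>u^3 \<tau>^2 + u^2 \<tau> + 1 = 0\<close> becomes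
  \<open>u s^2 + u s + 1 = 0\<close>.\<close>

definition artin_schreier_root :: "bit fls" where
  "artin_schreier_root = uvar * thue_morse_series"

lemma artin_schreier_root_eq:
  "artin_schreier_root = fps_to_fls ((1 + fps_X) * Abs_fps tm)"
proof -
  have tm: "thue_morse_series = fps_to_fls (fps_X * Abs_fps tm)"
    unfolding thue_morse_series_def by (rule arg_cong[of _ _ fps_to_fls]) (rule fps_ext, simp)
  have "artin_schreier_root = (fls_X_inv * fls_X) * fps_to_fls ((1 + fps_X) * Abs_fps tm)"
    unfolding artin_schreier_root_def uvar_eq tm
    by (simp only: fls_times_fps_to_fls fps_X_to_fls mult_ac)
  then show ?thesis
    by (simp add: fls_X_inv_times_conv_shift)
qed

text \<open>Multiplying the functional equation of \<open>T\<close> by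
  \<open>(1 + fps_X)\<^sup>2\<close> turns \<open>E\<close> into \<open>fps_X\<close>; a further
  factor \<open>fls_X_inv\<close> turns \<open>1 + fps_X\<close> into u and \<open>fps_X\<close>
  into 1.\<close>

lemma artin_schreier: "uvar * artin_schreier_root\<^sup>2 = uvar * artin_schreier_root + 1"
proof -
  define T where "T = Abs_fps tm"
  define E :: "bit fps" where "E = Abs_fps (\<lambda>n. if odd n then 1 else 0)"
  have T: "T = (1 + fps_X) * T\<^sup>2 + E" and E: "(1 + fps_X)\<^sup>2 * E = fps_X"
    using tm_fps_eq unfolding T_def E_def by auto
  have "y * (y * T)\<^sup>2 = y * (y * T) - y\<^sup>2 * E" if "T = y * T\<^sup>2 + E" for y
  proof -
    have "y * (y * (y * T\<^sup>2 + E)) - y\<^sup>2 * E = y * (y * T)\<^sup>2"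
      by (simp add: power2_eq_square algebra_simps)
    then show ?thesis using that by simp
  qed
  from this[OF T] have "(1 + fps_X) * ((1 + fps_X) * T)\<^sup>2 = (1 + fps_X) * ((1 + fps_X) * T) - fps_X"
    by (simp only: E)
  then have "fps_to_fls ((1 + fps_X) * ((1 + fps_X) * T)\<^sup>2) =
      fps_to_fls ((1 + fps_X) * ((1 + fps_X) * T)) - fls_X"
    by simp
  then have "uvar * artin_schreier_root\<^sup>2 = fls_X_inv * (fps_to_fls ((1 + fps_X) * ((1 + fps_X) * T)) - fls_X)"
    unfolding uvar_eq artin_schreier_root_eq T_def
    by (simp only: mult.assoc fls_times_fps_to_fls[symmetric] fps_to_fls_power[symmetric])
  also have "\<dots> = uvar * artin_schreier_root - fls_X_inv * fls_X"
    unfolding uvar_eq artin_schreier_root_eq T_def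
    by (simp only: right_diff_distrib mult.assoc fls_times_fps_to_fls)
  finally show ?thesis
    by (simp add: fls_minus_eq_plus fls_X_inv_times_conv_shift)
qed

lemma uvar_nonzero [simp]: "uvar \<noteq> 0"
  using artin_schreier by auto

lemma polyn_uvar [simp]: "polyn uvar"
  by (simp add: uvar_def polyn_add)

lemma deg_le_uvar: "deg_le uvar 1"
  unfolding uvar_def by (intro deg_le_add deg_le_tvar deg_le_1) simp

lemma deg_le_artin_schreier_root: "deg_le artin_schreier_root (- 1)"
  unfolding artin_schreier_root_eq deg_le_def
proof (intro allI impI)
  fix n :: int assume "n < - (- 1)"
  then consider "n < 0" | "n = 0" by linarith
  then show "fps_to_fls ((1 + fps_X) * Abs_fps tm) $$ n = 0"
  proof cases
    case 2
    then show ?thesis by (simp add: tm.simps)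
  qed simp
qed

lemma artin_schreier_root_nonzero [simp]: "artin_schreier_root \<noteq> 0"
  using artin_schreier by auto

text \<open>Iterated squaring, with \<open>h = 2^i\<close>: the square of the right side contains
  \<open>u^(2h) s^2\<close>, where one factor u is spent on \<open>u s^2 = u s + 1\<close>. This
  leaves the new polynomial \<open>u^(2h - 1) + R^2\<close>.\<close>

lemma artin_schreier_root_power:
  "\<exists>R. polyn R \<and> uvar ^ 2 ^ i * artin_schreier_root ^ 2 ^ Suc i =
    uvar ^ 2 ^ i * artin_schreier_root + R"
proof (induction i)
  case 0
  then show ?case
    using artin_schreier by (auto intro: exI[of _ 1])
next
  case (Suc i)
  let ?s = artin_schreier_root
  obtain R where R: "polyn R" "uvar ^ 2 ^ i * ?s ^ 2 ^ Suc i = uvar ^ 2 ^ i * ?s + R"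
    using Suc by blast
  obtain m where m: "(2::nat) ^ Suc i = Suc m"
    by (metis not0_implies_Suc power_not_zero zero_neq_numeral)
  have um: "uvar ^ 2 ^ Suc i = uvar * uvar ^ m"
    by (subst m) (rule power_Suc)
  have "uvar ^ 2 ^ Suc i * ?s ^ 2 ^ Suc (Suc i) = (uvar ^ 2 ^ i * ?s ^ 2 ^ Suc i)\<^sup>2"
    by (simp add: power_mult_distrib power_mult[symmetric] mult.commute)
  also have "\<dots> = (uvar ^ 2 ^ i * ?s)\<^sup>2 + R\<^sup>2"
    unfolding R(2) by (rule fls_square_add)
  also have "(uvar ^ 2 ^ i * ?s)\<^sup>2 = uvar ^ 2 ^ Suc i * ?s\<^sup>2"
    by (simp add: power_mult_distrib power_mult[symmetric] mult.commute)
  also have "\<dots> = uvar ^ m * (uvar * ?s\<^sup>2)"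
    by (simp only: um mult_ac)
  also have "\<dots> = uvar ^ 2 ^ Suc i * ?s + uvar ^ m"
    unfolding artin_schreier by (simp only: um distrib_left mult_ac mult_1_right mult_1_left)
  finally have "uvar ^ 2 ^ Suc i * ?s ^ 2 ^ Suc (Suc i) = uvar ^ 2 ^ Suc i * ?s + (uvar ^ m + R\<^sup>2)"
    by (simp only: add.assoc)
  then show ?case
    using R(1) by (intro exI[of _ "uvar ^ m + R\<^sup>2"] conjI polyn_add polyn_power polyn_uvar)
qed

text \<open>If \<open>Q s\<close> were a polynomial, so would be \<open>Q u^h s^(2h)\<close> for
  every \<open>h = 2^i\<close>. Its degree is at most \<open>d - h\<close>, so it would be zero once
  \<open>h > d\<close>.\<close>

lemma artin_schreier_root_irrational:
  assumes "polyn Q" "polyn P" "Q \<noteq> 0"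
  shows "Q * artin_schreier_root + P \<noteq> 0"
proof
  let ?s = artin_schreier_root
  assume 0: "Q * ?s + P = 0"
  obtain d where d: "deg_le Q d" using ex_deg_le by blast
  define i where "i = nat d"
  have i: "d < 2 ^ i"
  proof -
    have "i < 2 ^ i" by (rule less_exp)
    then have "int i < 2 ^ i" by (metis of_nat_less_iff of_nat_numeral of_nat_power)
    then show ?thesis unfolding i_def by linarith
  qed
  obtain R where R: "polyn R" "uvar ^ 2 ^ i * ?s ^ 2 ^ Suc i = uvar ^ 2 ^ i * ?s + R"
    using artin_schreier_root_power by blast
  let ?y = "Q * (uvar ^ 2 ^ i * ?s ^ 2 ^ Suc i)"
  have "?y = uvar ^ 2 ^ i * (Q * ?s) + Q * R"
    unfolding R(2) by (simp add: algebra_simps)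
  also have "Q * ?s = P"
    using 0 fls_eq_iff_add_eq_0 by blast
  finally have "polyn ?y"
    using assms R(1) by (simp add: polyn_add polyn_mult polyn_power)
  moreover have "deg_le ?y (d + (int (2 ^ i) * 1 + int (2 ^ Suc i) * (- 1)))"
    by (intro deg_le_mult deg_le_power d deg_le_uvar deg_le_artin_schreier_root)
  ultimately have "?y = 0"
    by (rule polyn_deg_neg) (use i in simp)
  then show False
    using assms(3) by simp
qed

subsection \<open>Vanishing entries of the number wall\<close>

lemma cf_frac_part_nth: "cf_frac_part x $$ n = (if 0 < n then x $$ n else 0)"
  by (cases "n < 0") (auto simp: cf_frac_part_def)

lemma polyn_add_cf_frac_part: "polyn (x + cf_frac_part x)"
  by (simp add: polyn_def cf_frac_part_nth bit_add_self del: add_bit_eq_xor)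

text \<open>Pigeonhole: the \<open>2^(N+1)\<close> polynomials of degree at most N produce only
  \<open>2^N\<close> patterns of the first N fractional coefficients of their product with x. The
  sum of two polynomials with the same pattern serves as Q.\<close>

lemma dirichlet_approximation:
  fixes x :: "bit fls"
  obtains Q P where "polyn Q" "polyn P" "Q \<noteq> 0" "deg_le Q (int N)" "deg_le (Q * x + P) (- int N - 1)"
proof -
  define q where "q A = (\<Sum>a\<in>A. tvar ^ a)" for A :: "nat set"
  define c where "c A = {i \<in> {1..N}. (q A * x) $$ int i = 1}" for A
  have q_nth: "q A $$ (- int a) = (if a \<in> A then 1 else 0)" if "finite A" for A a
  proof -
    have "q A $$ (- int a) = (\<Sum>b\<in>A. if a = b then 1 else 0)"
      unfolding q_def by (simp add: fls_nth_sum tvar_def)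
    also have "\<dots> = (if a \<in> A then 1 else 0)"
      using that by (simp add: sum.delta)
    finally show ?thesis .
  qed
  have "\<not> inj_on c (Pow {0..N})"
  proof
    assume "inj_on c (Pow {0..N})"
    moreover have "c ` Pow {0..N} \<subseteq> Pow {1..N}"
      unfolding c_def by blast
    ultimately have "card (Pow {0..N}) \<le> card (Pow {1..N})"
      by (rule card_inj_on_le) simp
    then show False
      by (simp add: card_Pow)
  qed
  then obtain A B where AB: "A \<subseteq> {0..N}" "B \<subseteq> {0..N}" "A \<noteq> B" "c A = c B"
    unfolding inj_on_def by blast
  define Q where "Q = q A + q B"
  have fin: "finite A" "finite B"
    using AB(1,2) by (auto intro: finite_subset)
  obtain a where a: "(a \<in> A) \<noteq> (a \<in> B)"
    using AB(3) by blast
  have "Q $$ (- int a) = 1"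
    unfolding Q_def fls_plus_nth q_nth[OF fin(1)] q_nth[OF fin(2)] using a by auto
  then have "Q \<noteq> 0" by auto
  have polyn_q: "polyn (q A)" for A
    unfolding q_def by (intro polyn_sum polyn_power polyn_tvar)
  then have "polyn Q"
    unfolding Q_def by (intro polyn_add)
  have deg_q: "deg_le (q A) (int N)" if "A \<subseteq> {0..N}" for A
  proof -
    have "finite A" using that finite_subset by auto
    then show ?thesis
      using that unfolding q_def
    proof (induction A)
      case (insert a A)
      have "deg_le (tvar ^ a) (int a * 1)"
        by (intro deg_le_power deg_le_tvar)
      then have "deg_le (tvar ^ a) (int N)"
        by (rule deg_le_mono) (use insert in auto)
      then show ?case
        using insert by (simp add: deg_le_add)
    qed simp
  qed
  have "deg_le Q (int N)"
    unfolding Q_def using AB by (intro deg_le_add deg_q)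
  define P where "P = Q * x + cf_frac_part (Q * x)"
  have "polyn P"
    unfolding P_def by (rule polyn_add_cf_frac_part)
  have "deg_le (Q * x + P) (- int N - 1)"
    unfolding deg_le_def
  proof (intro allI impI)
    fix n :: int assume n: "n < - (- int N - 1)"
    have "Q * x + P = cf_frac_part (Q * x)"
      by (simp only: P_def add.assoc[symmetric] fls_add_self add_0)
    moreover have "(Q * x) $$ n = 0" if "0 < n"
    proof -
      have m: "n = int (nat n)" "nat n \<in> {1..N}"
        using that n by auto
      have "nat n \<in> c A \<longleftrightarrow> nat n \<in> c B"
        by (simp only: AB(4))
      then have "(q A * x) $$ n = 1 \<longleftrightarrow> (q B * x) $$ n = 1"
        using m by (simp add: c_def)
      then have "(q A * x) $$ n = (q B * x) $$ n"
        by (metis bit_not_one_iff)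
      then show ?thesis
        unfolding Q_def distrib_right fls_plus_nth by (simp only: bit_add_self)
    qed
    ultimately show "(Q * x + P) $$ n = 0"
      by (simp add: cf_frac_part_nth)
  qed
  then show thesis
    by (intro that[of Q P] \<open>polyn Q\<close> \<open>Q \<noteq> 0\<close> \<open>deg_le Q (int N)\<close> \<open>polyn P\<close>)
qed

text \<open>Equivalently, the \<open>N \<times> N\<close> Hankel determinant of the coefficients of \<open>t\<^sup>k x\<close> is zero.\<close>

definition vanishing :: "bit fls \<Rightarrow> nat \<Rightarrow> int \<Rightarrow> bool" where
  "vanishing x k N \<longleftrightarrow> (\<exists>Q P. polyn Q \<and> polyn P \<and> Q \<noteq> 0 \<and>
     deg_le Q (N - 1) \<and> deg_le (Q * tvar ^ k * x + P) (- N - 1))"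

text \<open>This reflects the Desnanot--Jacobi identity \<open>c\<^sup>2 = l r + u d\<close> for Hankel determinants: modulo 2
  the five entries cannot all be 1.\<close>

lemma vanishing_cross:
  assumes "N \<ge> 1"
  shows "vanishing x k N \<or> vanishing x k (N + 1) \<or> vanishing x (Suc k) N \<or>
    vanishing x (Suc (Suc k)) N \<or> vanishing x (Suc (Suc k)) (N - 1)"
proof (rule ccontr)
  assume "\<not> ?thesis"
  then have nv: "\<not> vanishing x k N" "\<not> vanishing x k (N + 1)" "\<not> vanishing x (Suc k) N"
    "\<not> vanishing x (Suc (Suc k)) N" "\<not> vanishing x (Suc (Suc k)) (N - 1)"
    by auto
  have N: "int (nat N) = N" "int (nat (N - 1)) = N - 1"
    using assms by auto
  define y where "y = tvar ^ k * x"
  have y: "Q * tvar ^ k * x = Q * y" "Q * tvar ^ Suc k * x = Q * (tvar * y)"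
     "Q * tvar ^ Suc (Suc k) * x = Q * (tvar * (tvar * y))" for Q
    by (simp_all add: y_def mult_ac)
  note nv = nv[unfolded vanishing_def y]
  \<comment> \<open>One approximation of \<open>y\<close> and two of \<open>tvar * y\<close>.
    Nonvanishing forces exact degrees for \<open>Q\<close> and \<open>Q1\<close> and exact error
    orders for \<open>Q\<close> and \<open>Q0\<close>; the corresponding leading coefficients are
    then 1.\<close>
  obtain Q P where w: "polyn Q" "polyn P" "Q \<noteq> 0" "deg_le Q N" "deg_le (Q * y + P) (- N - 1)"
    using dirichlet_approximation[of "nat N" y] unfolding N by blast
  obtain Q1 P1 where v1: "polyn Q1" "polyn P1" "Q1 \<noteq> 0" "deg_le Q1 N"
      "deg_le (Q1 * (tvar * y) + P1) (- N - 1)"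
    using dirichlet_approximation[of "nat N" "tvar * y"] unfolding N by blast
  obtain Q0 P0 where v0: "polyn Q0" "polyn P0" "Q0 \<noteq> 0" "deg_le Q0 (N - 1)"
      "deg_le (Q0 * (tvar * y) + P0) (- N)"
    using dirichlet_approximation[of "nat (N - 1)" "tvar * y"] unfolding N by auto
  have 1: "Q $$ (- N) = 1"
    by (rule deg_le_exact[OF w(4)]) (use nv(1) w in blast)
  have "\<not> deg_le (Q * y + P) (- N - 1 - 1)"
  proof
    have N': "- N - 1 - 1 = - (N + 1) - 1" "N + 1 - 1 = N" by simp_all
    assume "deg_le (Q * y + P) (- N - 1 - 1)"
    then show False
      using nv(2) w(1-4) unfolding N' by blast
  qed
  then have "(Q * y + P) $$ (- (- N - 1)) = 1"
    by (rule deg_le_exact[OF w(5)])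
  then have 2: "(Q * y + P) $$ (N + 1) = 1"
    by (simp only: minus_diff_eq diff_minus_eq_add add.commute[of 1])
  have 3: "Q1 $$ (- N) = 1"
    by (rule deg_le_exact[OF v1(4)]) (use nv(3) v1 in blast)
  have "(Q0 * (tvar * y) + P0) $$ (- (- N)) = 1"
    by (rule deg_le_exact[OF v0(5)]) (use nv(3) v0 in blast)
  then have 4: "(Q0 * (tvar * y) + P0) $$ N = 1"
    by simp
  \<comment> \<open>Otherwise \<open>Q1 / t\<close> has degree at most \<open>N - 1\<close> and
    approximates \<open>t^2 y\<close> equally well, so the point \<open>(k + 2, N)\<close>
    vanishes.\<close>
  have 5: "Q1 $$ 0 \<noteq> 0"
  proof
    assume "Q1 $$ 0 = 0"
    then obtain R where R: "polyn R" "Q1 = tvar * R"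
      using polyn_divide_tvar v1(1) by blast
    have deg_R: "deg_le R (N - 1)"
      using v1(4) unfolding R(2) by (rule deg_le_tvar_timesD)
    have "Q1 * (tvar * y) = R * (tvar * (tvar * y))"
      by (simp only: R(2) mult_ac)
    with v1(5) have "deg_le (R * (tvar * (tvar * y)) + P1) (- N - 1)"
      by (simp only:)
    moreover have "R \<noteq> 0"
      using v1(3) R(2) by auto
    ultimately show False
      using nv(4) R(1) v1(2) deg_R by blast
  qed
  \<comment> \<open>The same division by t would make \<open>(k + 2, N - 1)\<close> vanish.\<close>
  have 6: "Q0 $$ 0 \<noteq> 0"
  proof
    assume "Q0 $$ 0 = 0"
    then obtain R where R: "polyn R" "Q0 = tvar * R"
      using polyn_divide_tvar v0(1) by blast
    have deg_R: "deg_le R (N - 1 - 1)"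
      using v0(4) unfolding R(2) by (rule deg_le_tvar_timesD)
    have "Q0 * (tvar * y) = R * (tvar * (tvar * y))"
      by (simp only: R(2) mult_ac)
    moreover have "- N = - (N - 1) - 1"
      by simp
    ultimately have "deg_le (R * (tvar * (tvar * y)) + P0) (- (N - 1) - 1)"
      using v0(5) by (simp only:)
    moreover have "R \<noteq> 0"
      using v0(3) R(2) by auto
    ultimately show False
      using nv(5) R(1) v0(2) deg_R by blast
  qed
  \<comment> \<open>The leading terms of \<open>Q1\<close> and \<open>Q\<close> cancel, as do the
    leading errors of \<open>Q\<close> (times t) and \<open>Q0\<close>. A nonzero sum would
    therefore witness vanishing at \<open>(k + 1, N)\<close>.\<close>
  have 7: "(Q1 + Q + Q0) = 0"
  proof (rule ccontr)
    assume "Q1 + Q + Q0 \<noteq> 0"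
    moreover have "polyn (Q1 + Q + Q0)" "polyn (P1 + tvar * P + P0)"
      by (intro polyn_add polyn_mult polyn_tvar w v0 v1)+
    moreover have "deg_le (Q1 + Q) N"
      using w v1 by (auto intro: deg_le_add)
    then have "deg_le (Q1 + Q) (N - 1)"
      by (rule deg_le_dec) (use 1 3 in simp)
    then have "deg_le (Q1 + Q + Q0) (N - 1)"
      using v0 by (auto intro: deg_le_add)
    moreover have "deg_le ((Q1 + Q + Q0) * (tvar * y) + (P1 + tvar * P + P0)) (- N - 1)"
    proof -
      let ?f = "Q1 * (tvar * y) + P1" and ?g = "tvar * (Q * y + P)" and ?h = "Q0 * (tvar * y) + P0"
      have "deg_le ?g (1 + (- N - 1))"
        using w by (intro deg_le_mult deg_le_tvar)
      then have "deg_le (?g + ?h) (- N)"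
        using v0 by (auto intro: deg_le_add)
      then have "deg_le (?g + ?h) (- N - 1)"
        by (rule deg_le_dec) (use 2 4 in simp)
      then have "deg_le (?f + (?g + ?h)) (- N - 1)"
        using v1 by (auto intro: deg_le_add)
      also have "?f + (?g + ?h) = (Q1 + Q + Q0) * (tvar * y) + (P1 + tvar * P + P0)"
        by (simp add: algebra_simps)
      finally show ?thesis .
    qed
    ultimately show False
      using nv(3) by blast
  qed
  \<comment> \<open>The constant terms of \<open>Q1\<close> and \<open>Q0\<close> are both 1, so t
    divides \<open>Q\<close>; then \<open>Q / t\<close> witnesses vanishing at
    \<open>(k + 1, N)\<close>.\<close>
  then have "(Q1 + Q + Q0) $$ 0 = 0" by simp
  then have "Q $$ 0 = 0"
    using 5 6 by (cases "Q $$ 0") simp_all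
  then obtain R where R: "polyn R" "Q = tvar * R"
    using polyn_divide_tvar w(1) by blast
  have deg_R: "deg_le R (N - 1)"
    using w(4) unfolding R(2) by (rule deg_le_tvar_timesD)
  have "Q * y = R * (tvar * y)"
    by (simp only: R(2) mult_ac)
  with w(5) have "deg_le (R * (tvar * y) + P) (- N - 1)"
    by (simp only:)
  moreover have "R \<noteq> 0"
    using w(3) R(2) by auto
  ultimately show False
    using nv(3) R(1) w(2) deg_R by blast
qed

text \<open>With \<open>h = 2\<^sup>i\<close> and \<open>n = 2h\<close>, the \<open>n\<close>-th power of an approximation \<open>P/Q\<close> of \<open>t\<^sup>k s\<close>, multiplied by
  \<open>u\<^sup>h\<close>, approximates \<open>t\<^bsup>kn\<^esup> s\<close>, because \<open>u\<^sup>h s\<^sup>n - u\<^sup>h s\<close> is a polynomial. One vanishing entry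
  thus becomes a window of vanishing entries whose size is proportional to \<open>n\<close>.\<close>

lemma vanishing_zoom:
  assumes "vanishing artin_schreier_root k N"
    and near: "\<bar>int K - 2 ^ Suc i * int k\<bar> + \<bar>M - 2 ^ Suc i * N\<bar> \<le> 2 ^ i - 2"
  shows "vanishing thue_morse_series K M"
proof -
  let ?s = artin_schreier_root and ?n = "2 ^ Suc i :: nat" and ?h = "2 ^ i :: nat"
  obtain Q P where QP: "polyn Q" "polyn P" "Q \<noteq> 0" "deg_le Q (N - 1)"
      "deg_le (Q * tvar ^ k * ?s + P) (- N - 1)"
    using assms(1) unfolding vanishing_def by blast
  obtain R where R: "polyn R" "uvar ^ ?h * ?s ^ ?n = uvar ^ ?h * ?s + R"
    using artin_schreier_root_power by blast
  \<comment> \<open>The exponent is \<open>h + 1\<close> because one factor u is spent on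
    \<open>s = u \<tau>\<close>.\<close>
  define Q' where "Q' = Q ^ ?n * uvar ^ Suc ?h"
  define P' where "P' = Q ^ ?n * tvar ^ (k * ?n) * R + P ^ ?n * uvar ^ ?h"
  have us: "uvar ^ Suc ?h * thue_morse_series = uvar ^ ?h * ?s"
    by (simp add: artin_schreier_root_def mult_ac)
  have "Q' * tvar ^ (k * ?n) * thue_morse_series + P' =
      Q ^ ?n * tvar ^ (k * ?n) * (uvar ^ Suc ?h * thue_morse_series) + P'"
    by (simp only: Q'_def mult_ac)
  also have "\<dots> = Q ^ ?n * tvar ^ (k * ?n) * (uvar ^ ?h * ?s + R) + P ^ ?n * uvar ^ ?h"
    unfolding us P'_def by (simp only: distrib_left add_ac)
  also have "\<dots> = uvar ^ ?h * ((Q * tvar ^ k * ?s) ^ ?n + P ^ ?n)"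
    unfolding R(2)[symmetric] power_mult_distrib power_mult by (simp only: distrib_left mult_ac)
  also have "\<dots> = uvar ^ ?h * (Q * tvar ^ k * ?s + P) ^ ?n"
    by (simp only: fls_frobenius_add)
  finally have err: "Q' * tvar ^ (k * ?n) * thue_morse_series + P' =
      uvar ^ ?h * (Q * tvar ^ k * ?s + P) ^ ?n" .
  have "deg_le (uvar ^ ?h * (Q * tvar ^ k * ?s + P) ^ ?n) (int ?h * 1 + int ?n * (- N - 1))"
    by (intro deg_le_mult deg_le_power deg_le_uvar QP)
  then have deg_err: "deg_le (Q' * tvar ^ (k * ?n) * thue_morse_series + P') (- int ?n * N - int ?h)"
    unfolding err by (rule deg_le_mono) (simp add: algebra_simps)
  have "deg_le Q' (int ?n * (N - 1) + int (Suc ?h) * 1)"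
    unfolding Q'_def by (intro deg_le_mult deg_le_power deg_le_uvar QP)
  then have deg_Q': "deg_le Q' (int ?n * N - int ?h + 1)"
    by (simp add: algebra_simps)
  have pol: "polyn Q'" "polyn P'" "Q' \<noteq> 0"
    unfolding Q'_def P'_def using QP R(1) by (auto intro!: polyn_add polyn_mult polyn_power)
  \<comment> \<open>The error has degree at most \<open>- n N - h\<close> and \<open>Q'\<close> has
    degree at most \<open>n N - h + 1\<close>. The requirements at \<open>(K, M)\<close> thus leave
    slack \<open>h - 1\<close> and \<open>h - 2\<close>; the smaller one is the bound here.\<close>
  have near': "\<bar>int K - int ?n * int k\<bar> + \<bar>M - int ?n * N\<bar> \<le> int ?h - 2"
    using near by simp
  show ?thesis
  proof (cases "k * ?n \<le> K")
    case True
    \<comment> \<open>To the right of \<open>n k\<close>, the whole error is multiplied by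
      \<open>t^j\<close>, and \<open>Q'\<close> stays the same.\<close>
    define j where "j = K - k * ?n"
    have K: "K = j + k * ?n"
      using True by (simp add: j_def)
    have j: "\<bar>int K - int ?n * int k\<bar> = int j"
      unfolding K of_nat_add of_nat_mult by (simp add: mult.commute)
    have "deg_le (tvar ^ j * (Q' * tvar ^ (k * ?n) * thue_morse_series + P')) (int j * 1 + (- int ?n * N - int ?h))"
      by (intro deg_le_mult deg_le_power deg_le_tvar deg_err)
    also have "tvar ^ j * (Q' * tvar ^ (k * ?n) * thue_morse_series + P') =
        Q' * tvar ^ K * thue_morse_series + tvar ^ j * P'"
      unfolding K power_add by (simp only: distrib_left mult_ac)
    finally have "deg_le (Q' * tvar ^ K * thue_morse_series + tvar ^ j * P') (- M - 1)"
      by (rule deg_le_mono) (use near' j in linarith)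
    moreover have "deg_le Q' (M - 1)"
      using deg_Q' by (rule deg_le_mono) (use near' in linarith)
    moreover have "polyn (tvar ^ j * P')"
      by (intro polyn_mult polyn_power polyn_tvar pol)
    ultimately show ?thesis
      unfolding vanishing_def using pol by blast
  next
    case False
    \<comment> \<open>To the left of \<open>n k\<close>, the surplus \<open>t^j\<close> is absorbed
      into the denominator, and the error stays the same.\<close>
    define j where "j = k * ?n - K"
    have K: "k * ?n = j + K"
      using False by (simp add: j_def)
    have "int ?n * int k = int j + int K"
      by (metis K of_nat_add of_nat_mult mult.commute)
    then have j: "\<bar>int K - int ?n * int k\<bar> = int j"
      by simp
    have "Q' * tvar ^ (k * ?n) * thue_morse_series = (tvar ^ j * Q') * tvar ^ K * thue_morse_series"
      unfolding K power_add by (simp only: mult_ac)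
    then have "deg_le ((tvar ^ j * Q') * tvar ^ K * thue_morse_series + P') (- int ?n * N - int ?h)"
      using deg_err by (simp only:)
    then have "deg_le ((tvar ^ j * Q') * tvar ^ K * thue_morse_series + P') (- M - 1)"
      by (rule deg_le_mono) (use near' in linarith)
    moreover have "deg_le (tvar ^ j * Q') (int j * 1 + (int ?n * N - int ?h + 1))"
      by (intro deg_le_mult deg_le_power deg_le_tvar deg_Q')
    then have "deg_le (tvar ^ j * Q') (M - 1)"
      by (rule deg_le_mono) (use near' j in linarith)
    moreover have "polyn (tvar ^ j * Q')"
      by (intro polyn_mult polyn_power polyn_tvar pol)
    ultimately show ?thesis
      unfolding vanishing_def using pol by (metis mult_eq_0_iff power_not_zero tvar_nonzero)
  qed
qed

subsection \<open>Continued fractions\<close>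

definition irrational_fls :: "bit fls \<Rightarrow> bool" where
  "irrational_fls x \<longleftrightarrow> (\<forall>Q P. polyn Q \<longrightarrow> polyn P \<longrightarrow> Q \<noteq> 0 \<longrightarrow> Q * x + P \<noteq> 0)"

lemma irrational_thue_morse: "irrational_fls (tvar ^ k * thue_morse_series)"
  unfolding irrational_fls_def
proof (intro allI impI notI)
  fix Q P
  assume *: "polyn Q" "polyn P" "Q \<noteq> 0" "Q * (tvar ^ k * thue_morse_series) + P = 0"
  have "(Q * tvar ^ k) * artin_schreier_root + uvar * P = uvar * (Q * (tvar ^ k * thue_morse_series) + P)"
    by (simp only: artin_schreier_root_def distrib_left mult_ac)
  also have "\<dots> = 0"
    unfolding *(4) by simp
  finally have "(Q * tvar ^ k) * artin_schreier_root + uvar * P = 0" .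
  moreover have "polyn (Q * tvar ^ k)" "polyn (uvar * P)"
    by (intro polyn_mult polyn_power polyn_tvar polyn_uvar *)+
  moreover have "Q * tvar ^ k \<noteq> 0"
    using *(3) by simp
  ultimately show False
    using artin_schreier_root_irrational by blast
qed

text \<open>Multiplying a polynomial relation for \<open>1/f\<close> by f gives one for x. Hence the
  expansion of an irrational series never meets the default value
  \<open>inverse 0 = 0\<close>.\<close>

lemma irrational_cf_step:
  assumes "irrational_fls x"
  shows "cf_frac_part x \<noteq> 0" "irrational_fls (inverse (cf_frac_part x))"
proof -
  let ?f = "cf_frac_part x"
  define a where "a = x + ?f"
  have a: "polyn a"
    unfolding a_def by (rule polyn_add_cf_frac_part)
  have f: "x + a = ?f"
    by (simp only: a_def add.assoc[symmetric] fls_add_self add_0)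
  have "1 * x + a \<noteq> 0"
    using assms a polyn_1 unfolding irrational_fls_def by (metis zero_neq_one)
  then show f0: "?f \<noteq> 0"
    unfolding f[symmetric] by simp
  show "irrational_fls (inverse ?f)"
    unfolding irrational_fls_def
  proof (intro allI impI notI)
    fix Q P
    assume *: "polyn Q" "polyn P" "Q \<noteq> 0" "Q * inverse ?f + P = 0"
    have "?f * (Q * inverse ?f + P) = Q + P * ?f"
      using f0 by (simp add: field_simps)
    then have 0: "Q + P * ?f = 0"
      using * by simp
    then have "P \<noteq> 0"
      using * by auto
    moreover have "P * x + (P * a + Q) = 0"
      using 0 unfolding f[symmetric] by (simp add: algebra_simps)
    moreover have "polyn (P * a + Q)"
      using * a by (simp add: polyn_add polyn_mult)
    ultimately show False
      using assms *(2) unfolding irrational_fls_def by blast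
  qed
qed

lemma irrational_cf_state: "irrational_fls x \<Longrightarrow> irrational_fls (cf_state x i)"
  by (induction i) (auto simp: irrational_cf_step)

lemma cf_state_add: "cf_state x (i + j) = cf_state (cf_state x i) j"
  by (induction j) auto

lemma deg_le_cf_frac_part: "deg_le (cf_frac_part x) (- 1)"
  by (simp add: deg_le_def cf_frac_part_nth)

lemma degree_cf_poly_part:
  assumes "fls_subdegree x < 0"
  shows "degree (cf_poly_part x) = nat (- fls_subdegree x)"
proof -
  have "degree (fls_prpart x + pCons (x $$ 0) 0) = degree (fls_prpart x)"
    by (rule degree_add_eq_left) (use assms in simp)
  then show ?thesis
    by (simp add: cf_poly_part_def)
qed

text \<open>From index 1 on, a complete quotient is the inverse of a series of degree at most -1, so
  its polynomial part is nonconstant. At index 0 the partial quotient may be constant.\<close>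

lemma degree_cf_pq_Suc:
  assumes "irrational_fls x"
  shows "int (degree (cf_pq x (Suc i))) = fls_subdegree (cf_frac_part (cf_state x i))"
    and "degree (cf_pq x (Suc i)) > 0"
proof -
  let ?f = "cf_frac_part (cf_state x i)"
  have "?f \<noteq> 0"
    using assms by (intro irrational_cf_step irrational_cf_state)
  then have "fls_subdegree ?f \<ge> 1"
    using deg_le_cf_frac_part[of "cf_state x i"] by (simp add: deg_le_iff)
  then show "int (degree (cf_pq x (Suc i))) = fls_subdegree ?f" "degree (cf_pq x (Suc i)) > 0"
    using \<open>?f \<noteq> 0\<close> by (simp_all add: cf_pq_def degree_cf_poly_part)
qed

text \<open>The degree of the denominator of the i-th convergent. The sum starts at partial quotient
  1, because the polynomial part of x does not enter the denominators.\<close>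

definition convergent_degree :: "bit fls \<Rightarrow> nat \<Rightarrow> nat" where
  "convergent_degree x i = (\<Sum>j<i. degree (cf_pq x (Suc j)))"

text \<open>Induction along \<open>x -> 1/f\<close> with the fractional part f: dividing
  \<open>Q x + P = Q f + P'\<close> by f makes \<open>P'\<close> the denominator for
  \<open>1/f\<close>, and the bounds shift by d, the degree of the first partial quotient.\<close>

lemma convergent_degree_best:
  assumes "irrational_fls x" "polyn Q" "polyn P" "Q \<noteq> 0" "deg_le Q (int (convergent_degree x i) - 1)"
  shows "\<not> deg_le (Q * x + P) (- int (convergent_degree x i) - 1)"
  using assms
proof (induction i arbitrary: x Q P)
  case 0
  then show ?case
    using polyn_deg_neg[of Q "-1"] by (simp add: convergent_degree_def)
next
  case (Suc i)
  define f y a where "f = cf_frac_part x" and "y = inverse f" and "a = x + f"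
  define n d where "n = convergent_degree y i" and "d = degree (cf_pq x 1)"
  have f: "f \<noteq> 0" and y: "irrational_fls y"
    unfolding f_def y_def using Suc.prems(1) by (rule irrational_cf_step)+
  have a: "polyn a"
    unfolding a_def f_def by (rule polyn_add_cf_frac_part)
  have d: "int d = fls_subdegree f" "d > 0"
    using degree_cf_pq_Suc[OF Suc.prems(1), of 0] by (simp_all add: d_def f_def)
  have "cf_pq x (Suc (Suc j)) = cf_pq y (Suc j)" for j
    using cf_state_add[of x 1 "Suc j"] by (simp add: cf_pq_def y_def f_def)
  then have n: "convergent_degree x (Suc i) = d + n"
    unfolding convergent_degree_def n_def d_def
    by (subst sum.lessThan_Suc_shift) simp
  define P' where "P' = P + Q * a"
  have P': "polyn P'"
    unfolding P'_def using Suc.prems a by (simp add: polyn_add polyn_mult)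
  have x: "x = a + f"
    by (simp only: a_def add.assoc fls_add_self add_0_right)
  have eq: "Q * x + P = Q * f + P'"
    unfolding P'_def by (subst x) (simp add: algebra_simps)
  show ?case
  proof
    assume "deg_le (Q * x + P) (- int (convergent_degree x (Suc i)) - 1)"
    then have le: "deg_le (Q * f + P') (- int (d + n) - 1)"
      unfolding eq n .
    have "deg_le f (- int d)" "deg_le y (int d)"
      using f by (simp_all add: deg_le_iff d y_def)
    have "deg_le Q (int (d + n) - 1)"
      using Suc.prems(5) unfolding n .
    from deg_le_mult[OF this \<open>deg_le f (- int d)\<close>] have Qf: "deg_le (Q * f) (int n - 1)"
      by simp
    show False
    proof (cases "P' = 0")
      case True
      \<comment> \<open>A nonzero polynomial has degree at least 0, so \<open>Q * f\<close> has
        degree at least \<open>- d\<close>, more than the assumed error allows.\<close>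
      have "fls_subdegree Q \<le> 0"
        using Suc.prems(2,4) by (metis linorder_not_le nth_fls_subdegree_nonzero polyn_def)
      then show False
        using le True f d Suc.prems(4) by (simp add: deg_le_iff)
    next
      case False
      have "deg_le (Q * f + (Q * f + P')) (int n - 1)"
        by (intro deg_le_add Qf deg_le_mono[OF le]) simp
      then have "deg_le P' (int n - 1)"
        by (simp only: add.assoc[symmetric] fls_add_self add_0)
      moreover have "deg_le ((Q * f + P') * y) (- int (d + n) - 1 + int d)"
        by (intro deg_le_mult le \<open>deg_le y (int d)\<close>)
      moreover have "(Q * f + P') * y = P' * y + Q"
        using f by (simp add: y_def field_simps)
      ultimately show False
        using Suc.IH[OF y P' Suc.prems(2) False] by (simp add: n_def)
    qed
  qed
qed

text \<open>In characteristic 2 the middle coefficient \<open>B\<close> of the quadratic equation does not change.\<close>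

lemma cf_state_quadratic_step:
  assumes "irrational_fls x" "polyn A" "polyn B" "polyn C" "A * x\<^sup>2 + B * x + C = 0"
  defines "y \<equiv> inverse (cf_frac_part x)"
  shows "\<exists>A'. polyn A' \<and> A' * y\<^sup>2 + B * y + A = 0"
proof -
  define f a where "f = cf_frac_part x" and "a = x + f"
  have f: "f \<noteq> 0"
    unfolding f_def using assms(1) by (rule irrational_cf_step)
  have a: "polyn a"
    unfolding a_def f_def by (rule polyn_add_cf_frac_part)
  have x: "x = a + f"
    by (simp only: a_def add.assoc fls_add_self add_0_right)
  have "(A * a\<^sup>2 + B * a + C) + B * f + A * f\<^sup>2 = A * (a\<^sup>2 + f\<^sup>2) + B * (a + f) + C"
    by (simp add: algebra_simps)
  also have "\<dots> = 0"
    using assms(5) unfolding x fls_square_add .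
  finally have "((A * a\<^sup>2 + B * a + C) + B * f + A * f\<^sup>2) * y\<^sup>2 = 0"
    by simp
  moreover have "((A * a\<^sup>2 + B * a + C) + B * f + A * f\<^sup>2) * y\<^sup>2 = (A * a\<^sup>2 + B * a + C) * y\<^sup>2 + B * y + A"
  proof -
    have "f * y = 1"
      using f by (simp add: y_def f_def)
    moreover have "((A * a\<^sup>2 + B * a + C) + B * f + A * f\<^sup>2) * y\<^sup>2 =
        (A * a\<^sup>2 + B * a + C) * y\<^sup>2 + B * y * (f * y) + A * (f * y)\<^sup>2"
      by (simp add: power2_eq_square algebra_simps)
    ultimately show ?thesis by simp
  qed
  moreover have "polyn (A * a\<^sup>2 + B * a + C)"
    using assms a by (simp add: polyn_add polyn_mult polyn_power)
  ultimately show ?thesis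
    by auto
qed

text \<open>Multiplication by \<open>f^2\<close> gives \<open>A = B f + C f^2\<close> with f of
  negative degree. Since \<open>A\<close> is the constant coefficient of the next equation, the
  degrees fall step by step to the level of \<open>B\<close>.\<close>

lemma deg_le_leading_coeff:
  assumes "A * y\<^sup>2 + B * y + C = 0" "y = inverse f" "f \<noteq> 0" "deg_le f (- 1)" "deg_le B b" "deg_le C M"
  shows "deg_le (A :: bit fls) (max b (M - 1))"
proof -
  have "f * y = 1"
    using assms(2,3) by simp
  moreover have "(A * y\<^sup>2 + B * y + C) * f\<^sup>2 = A * (f * y)\<^sup>2 + (B * f * (f * y) + C * f\<^sup>2)"
    by (simp add: power2_eq_square algebra_simps)
  ultimately have "A + (B * f + C * f\<^sup>2) = 0"
    using assms(1) by simp
  then have A: "A = B * f + C * f\<^sup>2"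
    by (rule fls_eq_iff_add_eq_0[THEN iffD2])
  have "deg_le (B * f) (b + - 1)" "deg_le (C * f\<^sup>2) (M + int 2 * - 1)"
    by (intro deg_le_mult deg_le_power assms)+
  then show ?thesis
    unfolding A by (intro deg_le_add) (auto elim: deg_le_mono)
qed

lemma finite_quadratic_roots:
  assumes "(B :: 'a::idom) \<noteq> 0"
  shows "finite {y. A * y\<^sup>2 + B * y + C = 0}"
proof -
  have "{y. A * y\<^sup>2 + B * y + C = 0} = {y. poly [:C, B, A:] y = 0}"
    by (simp add: power2_eq_square algebra_simps)
  then show ?thesis
    using poly_roots_finite[of "[:C, B, A:]"] assms by simp
qed

text \<open>Lagrange's theorem: the complete quotients satisfy quadratic equations with fixed
  \<open>B\<close> and outer coefficients of eventually bounded degree. There are finitely many such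
  equations, so some complete quotient recurs.\<close>

lemma cf_pq_eventually_periodic:
  assumes irr: "irrational_fls x" and ABC: "polyn A" "polyn B" "polyn C" "B \<noteq> 0"
    and eq: "A * x\<^sup>2 + B * x + C = 0"
  shows "\<exists>l>0. \<exists>N. \<forall>i\<ge>N. cf_pq x (i + l) = cf_pq x i"
proof -
  obtain b where b: "deg_le B b" using ex_deg_le by blast
  define quad where "quad i M \<longleftrightarrow> (\<exists>A C. polyn A \<and> polyn C \<and> deg_le C M \<and>
    A * (cf_state x i)\<^sup>2 + B * cf_state x i + C = 0)" for i M
  have lead: "deg_le A' (max b (M - 1))"
    if "A' * (cf_state x (Suc i))\<^sup>2 + B * cf_state x (Suc i) + C' = 0" "deg_le C' M" for A' C' i M
    using that(1) cf_state.simps(2)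
      irrational_cf_step(1)[OF irrational_cf_state[OF irr]] deg_le_cf_frac_part b that(2)
    by (rule deg_le_leading_coeff)
  \<comment> \<open>The start is at index 1, where the state is the inverse of a fractional part, as
    \<open>lead\<close> requires.\<close>
  have "\<exists>M. quad (Suc 0) M"
  proof -
    obtain A' where "polyn A'" "A' * (inverse (cf_frac_part x))\<^sup>2 + B * inverse (cf_frac_part x) + A = 0"
      using cf_state_quadratic_step[OF irr ABC(1-3) eq] by blast
    moreover obtain M where "deg_le A M" using ex_deg_le by blast
    ultimately show ?thesis
      unfolding quad_def using ABC(1) by auto
  qed
  then obtain M where M: "quad (Suc 0) M" by blast
  have quad: "quad (Suc i) (max b (M - int i))" for i
  proof (induction i)
    case 0
    obtain A' C' where "polyn A'" "polyn C'" "deg_le C' M"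
        "A' * (cf_state x (Suc 0))\<^sup>2 + B * cf_state x (Suc 0) + C' = 0"
      using M unfolding quad_def by blast
    moreover from this(3) have "deg_le C' (max b (M - int 0))"
      by (rule deg_le_mono) simp
    ultimately show ?case
      unfolding quad_def by blast
  next
    case (Suc i)
    then obtain A' C' where *: "polyn A'" "polyn C'" "deg_le C' (max b (M - int i))"
        "A' * (cf_state x (Suc i))\<^sup>2 + B * cf_state x (Suc i) + C' = 0"
      unfolding quad_def by blast
    from lead[OF *(4,3)] have "deg_le A' (max b (M - int (Suc i)))"
      by (rule deg_le_mono) simp
    moreover obtain A'' where "polyn A''"
        "A'' * (cf_state x (Suc (Suc i)))\<^sup>2 + B * cf_state x (Suc (Suc i)) + A' = 0"
      using cf_state_quadratic_step[OF irrational_cf_state[OF irr] *(1) ABC(2) *(2,4)] by auto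
    ultimately show ?case
      unfolding quad_def using *(1) by blast
  qed
  define S where "S = {p :: bit fls. polyn p \<and> deg_le p b}"
  define F where "F = (\<Union>A\<in>S. \<Union>C\<in>S. {y. A * y\<^sup>2 + B * y + C = 0})"
  have "finite S"
    unfolding S_def by (rule finite_polyn_deg_le)
  then have "finite F"
    unfolding F_def using ABC(4) by (intro finite_UN_I finite_quadratic_roots)
  \<comment> \<open>After m steps the bound \<open>max b (M - int i)\<close> has reached b, so both
    outer coefficients lie in \<open>S\<close>.\<close>
  define m where "m = nat (M - b)"
  have "cf_state x (Suc (m + i)) \<in> F" for i
  proof -
    have "max b (M - int (m + i)) = b"
      unfolding m_def by simp
    with quad[of "m + i"] obtain A' C' where *: "polyn A'" "polyn C'" "deg_le C' b"
        "A' * (cf_state x (Suc (m + i)))\<^sup>2 + B * cf_state x (Suc (m + i)) + C' = 0"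
      unfolding quad_def by auto
    from lead[OF *(4,3)] have "deg_le A' b"
      by simp
    with * show ?thesis
      unfolding F_def S_def by blast
  qed
  then have "range (\<lambda>i. cf_state x (Suc (m + i))) \<subseteq> F"
    by blast
  then have "finite (range (\<lambda>i. cf_state x (Suc (m + i))))"
    using \<open>finite F\<close> by (rule finite_subset)
  then have "\<not> inj (\<lambda>i. cf_state x (Suc (m + i)))"
    by (metis finite_imageD infinite_UNIV_nat)
  then obtain i' j' where ij': "i' \<noteq> j'" "cf_state x (Suc (m + i')) = cf_state x (Suc (m + j'))"
    unfolding inj_on_def by blast
  have "\<exists>i j. i < j \<and> cf_state x (Suc (m + i)) = cf_state x (Suc (m + j))"
  proof (cases "i' < j'")
    case True
    then show ?thesis using ij'(2) by blast
  next
    case False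
    then have "j' < i'" using ij'(1) by linarith
    then show ?thesis using ij'(2)[symmetric] by blast
  qed
  then obtain i j where ij: "i < j" "cf_state x (Suc (m + i)) = cf_state x (Suc (m + j))"
    by blast
  show ?thesis
  proof (intro exI conjI allI impI)
    show "0 < j - i"
      using ij(1) by simp
    fix n assume "Suc (m + i) \<le> n"
    then obtain q where n: "n = Suc (m + i) + q"
      by (rule le_Suc_ex[THEN exE])
    have "n + (j - i) = Suc (m + j) + q"
      using n ij(1) by linarith
    then have "cf_state x (n + (j - i)) = cf_state (cf_state x (Suc (m + j))) q"
      by (simp only: cf_state_add)
    also have "\<dots> = cf_state x n"
      unfolding n ij(2)[symmetric] by (rule cf_state_add[symmetric])
    finally show "cf_pq x (n + (j - i)) = cf_pq x n"
      by (simp only: cf_pq_def)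
  qed
qed

lemma thue_morse_cf_pq_eventually_periodic:
  "\<exists>l>0. \<exists>N. \<forall>i\<ge>N. cf_pq (tvar ^ k * thue_morse_series) (i + l) = cf_pq (tvar ^ k * thue_morse_series) i"
proof (rule cf_pq_eventually_periodic)
  let ?x = "tvar ^ k * thue_morse_series"
  \<comment> \<open>This is \<open>u s^2 + u s + 1 = 0\<close> with \<open>s = u \<tau>\<close>,
    multiplied by \<open>t^(2k)\<close>.\<close>
  have "uvar ^ 3 * ?x\<^sup>2 + uvar\<^sup>2 * tvar ^ k * ?x + (tvar ^ k)\<^sup>2 =
      (tvar ^ k)\<^sup>2 * (uvar * artin_schreier_root\<^sup>2 + (uvar * artin_schreier_root + 1))"
    by (simp add: artin_schreier_root_def power2_eq_square power3_eq_cube algebra_simps)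
  also have "\<dots> = 0"
    unfolding artin_schreier fls_add_self by simp
  finally show "uvar ^ 3 * ?x\<^sup>2 + uvar\<^sup>2 * tvar ^ k * ?x + (tvar ^ k)\<^sup>2 = 0" .
qed (intro irrational_thue_morse polyn_power polyn_mult polyn_uvar polyn_tvar | simp)+

subsection \<open>Periods\<close>

lemma convergent_degree_add:
  "convergent_degree x (i + m) = convergent_degree x i + (\<Sum>j<m. degree (cf_pq x (Suc i + j)))"
  by (induction m) (simp_all add: convergent_degree_def)

lemma strict_mono_convergent_degree:
  assumes "irrational_fls x"
  shows "strict_mono (convergent_degree x)"
  unfolding strict_mono_Suc_iff
proof
  fix i
  show "convergent_degree x i < convergent_degree x (Suc i)"
    using degree_cf_pq_Suc(2)[OF assms, of i] by (simp add: convergent_degree_def)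
qed

lemma periodic_sum_shift:
  fixes d :: "nat \<Rightarrow> nat"
  assumes "\<And>i. p \<le> i \<Longrightarrow> d (i + l) = d i" and "p \<le> i"
  shows "(\<Sum>j<l. d (i + j)) = (\<Sum>j<l. d (p + j))"
  using assms(2)
proof (induction i rule: dec_induct)
  case (step i)
  have "d i + (\<Sum>j<l. d (Suc i + j)) = (\<Sum>j<Suc l. d (i + j))"
    by (subst sum.lessThan_Suc_shift) simp
  also have "\<dots> = (\<Sum>j<l. d (i + j)) + d i"
    using assms(1)[OF step.hyps(1)] by simp
  finally show ?case
    using step.IH by simp
qed simp

text \<open>Periodicity ensures that the \<open>LEAST\<close> in \<open>cf_period\<close> and in
  \<open>cf_preperiod\<close> is attained.\<close>

locale periodic_cf =
  fixes x :: "bit fls"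
  assumes irrational: "irrational_fls x"
    and periodic: "\<exists>l>0. \<exists>N. \<forall>i\<ge>N. cf_pq x (i + l) = cf_pq x i"
begin

definition mass :: nat where
  "mass = (\<Sum>i\<in>cf_period_indices x. degree (cf_pq x i))"

lemma cf_period_pos: "cf_period x > 0"
  and cf_period_ex: "\<exists>N. \<forall>i\<ge>N. cf_pq x (i + cf_period x) = cf_pq x i"
  using LeastI_ex[OF periodic, folded cf_period_def] by blast+

lemma cf_pq_add_period: "cf_preperiod x \<le> i \<Longrightarrow> cf_pq x (i + cf_period x) = cf_pq x i"
  using LeastI_ex[OF cf_period_ex, folded cf_preperiod_def] by blast

lemma card_cf_period_indices: "card (cf_period_indices x) = cf_period x"
  by (simp add: cf_period_indices_def)

lemma mass_eq: "mass = (\<Sum>j<cf_period x. degree (cf_pq x (cf_preperiod x + j)))"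
  unfolding mass_def cf_period_indices_def
  by (rule sum.reindex_bij_witness[of _ "\<lambda>j. cf_preperiod x + j" "\<lambda>i. i - cf_preperiod x"]) auto

lemma mass_pos: "mass > 0"
proof -
  \<comment> \<open>The preperiod may be 0 and partial quotient 0 constant, so one period is added
    to reach a positive index.\<close>
  have "cf_pq x (cf_preperiod x) = cf_pq x (cf_preperiod x + cf_period x)"
    using cf_pq_add_period[of "cf_preperiod x"] by simp
  moreover obtain m where "cf_preperiod x + cf_period x = Suc m"
    using cf_period_pos gr0_conv_Suc by auto
  ultimately have "degree (cf_pq x (cf_preperiod x)) > 0"
    using degree_cf_pq_Suc(2)[OF irrational] by simp
  moreover have "degree (cf_pq x (cf_preperiod x)) \<le> mass"
    unfolding mass_def using cf_period_pos by (intro member_le_sum) (auto simp: cf_period_indices_def)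
  ultimately show ?thesis by simp
qed

lemma convergent_degree_period:
  "convergent_degree x (cf_preperiod x + c * cf_period x) = convergent_degree x (cf_preperiod x) + c * mass"
proof (induction c)
  case (Suc c)
  let ?i = "cf_preperiod x + c * cf_period x"
  have "convergent_degree x (?i + cf_period x) = convergent_degree x ?i + mass"
    unfolding convergent_degree_add mass_eq
    by (subst periodic_sum_shift[where d = "\<lambda>i. degree (cf_pq x i)" and p = "cf_preperiod x"])
      (simp_all add: cf_pq_add_period)
  then show ?case
    using Suc by (simp add: algebra_simps)
qed simp

text \<open>Each period contributes \<open>cf_period x\<close> convergent degrees within a length of
  \<open>mass\<close>. The term -1 pays for the last, incomplete period.\<close>

lemma card_convergent_degrees:
  "real (cf_period x) * ((real M - real (convergent_degree x (cf_preperiod x))) / real mass - 1)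
    \<le> real (card (range (convergent_degree x) \<inter> {..<M}))"
proof (cases "convergent_degree x (cf_preperiod x) \<le> M")
  case False
  then have "(real M - real (convergent_degree x (cf_preperiod x))) / real mass \<le> 0"
    by (simp add: divide_nonpos_nonneg)
  then have "real (cf_period x) * ((real M - real (convergent_degree x (cf_preperiod x))) / real mass - 1) \<le> 0"
    by (intro mult_nonneg_nonpos) auto
  then show ?thesis
    by (rule order_trans) simp
next
  case True
  let ?s = "convergent_degree x (cf_preperiod x)"
  define c where "c = (M - ?s) div mass"
  let ?I = "{cf_preperiod x ..< cf_preperiod x + c * cf_period x}"
  have mono: "strict_mono (convergent_degree x)"
    using irrational by (rule strict_mono_convergent_degree)
  have "?s + c * mass \<le> M"
    using True unfolding c_def by (metis add_le_cancel_left div_times_less_eq_dividend le_add_diff_inverse)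
  then have "convergent_degree x i < M" if "i \<in> ?I" for i
    using strict_mono_less[OF mono, of i "cf_preperiod x + c * cf_period x"] that
    unfolding convergent_degree_period by simp
  then have "convergent_degree x ` ?I \<subseteq> range (convergent_degree x) \<inter> {..<M}"
    by blast
  then have "card (convergent_degree x ` ?I) \<le> card (range (convergent_degree x) \<inter> {..<M})"
    by (intro card_mono) auto
  also have "card (convergent_degree x ` ?I) = c * cf_period x"
    using strict_mono_imp_inj_on[OF mono] by (subst card_image) (auto intro: inj_on_subset)
  finally have "real c * real (cf_period x) \<le> real (card (range (convergent_degree x) \<inter> {..<M}))"
    by (metis of_nat_le_iff of_nat_mult)
  moreover have "(real M - real ?s) / real mass - 1 \<le> real c"
  proof -
    have "M - ?s < mass + mass * c"
      unfolding c_def by (rule dividend_less_times_div[OF mass_pos])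
    then have "M < ?s + (mass + mass * c)"
      using True by linarith
    then have "real M < real (?s + (mass + mass * c))"
      by (simp only: of_nat_less_iff)
    then show ?thesis
      using mass_pos by (simp add: field_simps)
  qed
  then have "real (cf_period x) * ((real M - real ?s) / real mass - 1) \<le> real (cf_period x) * real c"
    by (intro mult_left_mono) auto
  ultimately show ?thesis
    by (simp add: mult.commute)
qed

text \<open>Truncation removes at most n from each of the \<open>cf_period x\<close>
  degrees.\<close>

lemma escaped_mass_ge:
  "1 - real n * real (cf_period x) / real mass \<le>
    (\<Sum>i\<in>cf_period_indices x. real (degree (cf_pq x i) - n)) /
    (\<Sum>i\<in>cf_period_indices x. real (degree (cf_pq x i)))"
proof -
  have "real mass - real n * real (cf_period x) =
      (\<Sum>i\<in>cf_period_indices x. real (degree (cf_pq x i)) - real n)"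
    by (simp add: sum_subtractf card_cf_period_indices mass_def)
  also have "\<dots> \<le> (\<Sum>i\<in>cf_period_indices x. real (degree (cf_pq x i) - n))"
    by (intro sum_mono) simp
  finally have "(real mass - real n * real (cf_period x)) / real mass \<le>
      (\<Sum>i\<in>cf_period_indices x. real (degree (cf_pq x i) - n)) / real mass"
    by (intro divide_right_mono) auto
  moreover have "real mass = (\<Sum>i\<in>cf_period_indices x. real (degree (cf_pq x i)))"
    by (simp add: mass_def)
  moreover have "(real mass - real n * real (cf_period x)) / real mass = 1 - real n * real (cf_period x) / real mass"
    using mass_pos by (simp add: diff_divide_distrib)
  ultimately show ?thesis
    by (simp only:)
qed

end

section \<open>Porosity and counting of the nonvanishing points\<close>

interpretation tm_cf: periodic_cf "tvar ^ k * thue_morse_series" for k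
  by standard (rule irrational_thue_morse, rule thue_morse_cf_pq_eventually_periodic)

text \<open>The link from continued fractions to the number wall: an upper bound on nonvanishing
  points bounds the number of partial quotients.\<close>

lemma convergent_degree_not_vanishing:
  "\<not> vanishing thue_morse_series k (int (convergent_degree (tvar ^ k * thue_morse_series) i))"
  unfolding vanishing_def
  using convergent_degree_best[OF irrational_thue_morse[of k]] by (metis mult.assoc)

text \<open>A vanishing point of s in the 4 by 4 block at \<open>(4p, 4q)\<close>, enlarged by the
  factor \<open>4 * 16^j\<close>, yields a window for \<tau> that contains one whole cell of side
  \<open>16^j\<close>.\<close>

lemma vanishing_porous:
  "\<exists>a<16. \<exists>b<16.
    \<forall>K \<in> {16 ^ j * (16 * p + a) ..< 16 ^ j * (16 * p + a + 1)}.
    \<forall>M \<in> {16 ^ j * (16 * q + b) ..< 16 ^ j * (16 * q + b + 1)}.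
      vanishing thue_morse_series K (int M)"
proof -
  \<comment> \<open>The cross is centred at \<open>(4p + 2, 4q + 2)\<close>, so all its points have
    offsets 1, 2 or 3 in the block.\<close>
  have ge: "1 \<le> int (4 * q + 2)" by simp
  have "\<exists>a b. a \<in> {1, 2, 3} \<and> b \<in> {1, 2, 3} \<and>
      vanishing artin_schreier_root (4 * p + a) (int (4 * q + b))"
    using vanishing_cross[OF ge, of artin_schreier_root "4 * p + 1"]
  proof (elim disjE)
    assume "vanishing artin_schreier_root (4 * p + 1) (int (4 * q + 2))"
    then show ?thesis by (intro exI[of _ 1] exI[of _ 2]) simp
  next
    assume "vanishing artin_schreier_root (4 * p + 1) (int (4 * q + 2) + 1)"
    then show ?thesis by (intro exI[of _ 1] exI[of _ 3]) (simp add: add.commute)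
  next
    assume "vanishing artin_schreier_root (Suc (4 * p + 1)) (int (4 * q + 2))"
    then show ?thesis by (intro exI[of _ 2] exI[of _ 2]) simp
  next
    assume "vanishing artin_schreier_root (Suc (Suc (4 * p + 1))) (int (4 * q + 2))"
    then show ?thesis by (intro exI[of _ 3] exI[of _ 2]) (simp add: numeral_3_eq_3)
  next
    assume "vanishing artin_schreier_root (Suc (Suc (4 * p + 1))) (int (4 * q + 2) - 1)"
    then show ?thesis by (intro exI[of _ 3] exI[of _ 1]) (simp add: numeral_3_eq_3)
  qed
  then obtain a b where ab: "a \<in> {1, 2, 3}" "b \<in> {1, 2, 3}"
      "vanishing artin_schreier_root (4 * p + a) (int (4 * q + b))" by blast
  define H :: nat where "H = 16 ^ j"
  have H: "2 ^ Suc (Suc (4 * j)) = 4 * int H" "2 ^ Suc (4 * j) = 2 * int H"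
    by (simp_all add: H_def power_mult)
  show ?thesis
  proof (rule exI[of _ "4 * a"], rule conjI[rotated], rule exI[of _ "4 * b"], rule conjI[rotated], intro ballI)
    fix K M
    assume "K \<in> {16 ^ j * (16 * p + 4 * a) ..< 16 ^ j * (16 * p + 4 * a + 1)}"
      "M \<in> {16 ^ j * (16 * q + 4 * b) ..< 16 ^ j * (16 * q + 4 * b + 1)}"
    then have "4 * H * (4 * p + a) \<le> K" "K < 4 * H * (4 * p + a) + H"
        "4 * H * (4 * q + b) \<le> M" "M < 4 * H * (4 * q + b) + H"
      unfolding H_def[symmetric] by (simp_all add: algebra_simps)
    then have "int (4 * H * (4 * p + a)) \<le> int K" "int K < int (4 * H * (4 * p + a) + H)"
        "int (4 * H * (4 * q + b)) \<le> int M" "int M < int (4 * H * (4 * q + b) + H)"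
      by (simp_all only: of_nat_le_iff of_nat_less_iff)
    \<comment> \<open>With exponent \<open>4j + 1\<close> the zoom has \<open>n = 4H\<close> and
      \<open>h = 2H\<close>. Within the cell each coordinate deviates by at most
      \<open>H - 1\<close>, and \<open>2 (H - 1)\<close> is exactly the permitted
      \<open>h - 2\<close>.\<close>
    then have "\<bar>int K - 4 * int H * int (4 * p + a)\<bar> + \<bar>int M - 4 * int H * int (4 * q + b)\<bar> \<le> 2 * int H - 2"
      unfolding of_nat_add of_nat_mult of_nat_numeral by linarith
    then show "vanishing thue_morse_series K (int M)"
      by (intro vanishing_zoom[OF ab(3), of K "Suc (4 * j)"]) (simp only: H)
  qed (use ab in auto)
qed

definition nonvanishing_box :: "nat \<Rightarrow> nat \<Rightarrow> nat \<Rightarrow> (nat \<times> nat) set" where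
  "nonvanishing_box j p q = {(k, N). k \<in> {16 ^ j * p ..< 16 ^ j * (p + 1)} \<and>
     N \<in> {16 ^ j * q ..< 16 ^ j * (q + 1)} \<and> \<not> vanishing thue_morse_series k (int N)}"

lemma finite_nonvanishing_box: "finite (nonvanishing_box j p q)"
  by (rule finite_subset[of _ "{16 ^ j * p ..< 16 ^ j * (p + 1)} \<times> {16 ^ j * q ..< 16 ^ j * (q + 1)}"])
    (auto simp: nonvanishing_box_def)

lemma subinterval_digit:
  fixes n h p :: nat
  assumes "n \<in> {16 * h * p ..< 16 * h * (p + 1)}"
  shows "\<exists>a<16. n \<in> {h * (16 * p + a) ..< h * (16 * p + a + 1)}"
proof (intro exI conjI)
  have h: "h > 0"
    using assms by (cases "h = 0") auto
  define a where "a = (n - 16 * h * p) div h"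
  have n: "n = 16 * h * p + (n - 16 * h * p)"
    using assms by simp
  have "n - 16 * h * p < 16 * h"
  proof -
    have "16 * h * p \<le> n" "n < 16 * h * p + 16 * h"
      using assms by simp_all
    then show ?thesis by linarith
  qed
  then show "a < 16"
    unfolding a_def using h by (simp add: less_mult_imp_div_less)
  have "h * a \<le> n - 16 * h * p" "n - 16 * h * p < h * a + h"
    unfolding a_def using dividend_less_times_div[OF h, of "n - 16 * h * p"] by (simp_all add: add.commute)
  then show "n \<in> {h * (16 * p + a) ..< h * (16 * p + a + 1)}"
    by (subst n) (simp add: algebra_simps)
qed

text \<open>By porosity one of the 256 cells of each box is empty, so every scale contributes a
  factor of at most 255.\<close>

lemma card_nonvanishing_box: "card (nonvanishing_box j p q) \<le> 255 ^ j"
proof (induction j arbitrary: p q)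
  case 0
  have "nonvanishing_box 0 p q \<subseteq> {(p, q)}"
    by (auto simp: nonvanishing_box_def)
  then have "card (nonvanishing_box 0 p q) \<le> card {(p, q)}"
    by (intro card_mono) auto
  then show ?case by simp
next
  case (Suc j)
  let ?I = "{..<16} \<times> {..<16 :: nat}"
  let ?B = "\<lambda>(a, b). nonvanishing_box j (16 * p + a) (16 * q + b)"
  obtain a b where ab: "a < 16" "b < 16"
    "\<forall>K \<in> {16 ^ j * (16 * p + a) ..< 16 ^ j * (16 * p + a + 1)}.
     \<forall>M \<in> {16 ^ j * (16 * q + b) ..< 16 ^ j * (16 * q + b + 1)}.
      vanishing thue_morse_series K (int M)"
    using vanishing_porous by blast
  have empty: "?B (a, b) = {}"
    using ab(3) by (auto simp: nonvanishing_box_def)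
  have "nonvanishing_box (Suc j) p q \<subseteq> (\<Union>i\<in>?I. ?B i)"
  proof clarify
    fix k N assume kN: "(k, N) \<in> nonvanishing_box (Suc j) p q"
    then have "k \<in> {16 * 16 ^ j * p ..< 16 * 16 ^ j * (p + 1)}" "N \<in> {16 * 16 ^ j * q ..< 16 * 16 ^ j * (q + 1)}"
      by (simp_all only: nonvanishing_box_def power_Suc mem_Collect_eq prod.case)
    then obtain c d where "c < 16" "d < 16" "k \<in> {16 ^ j * (16 * p + c) ..< 16 ^ j * (16 * p + c + 1)}"
        "N \<in> {16 ^ j * (16 * q + d) ..< 16 ^ j * (16 * q + d + 1)}"
      using subinterval_digit by meson
    then show "(k, N) \<in> (\<Union>i\<in>?I. ?B i)"
      using kN by (intro UN_I[of "(c, d)"]) (simp_all add: nonvanishing_box_def)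
  qed
  then have "card (nonvanishing_box (Suc j) p q) \<le> card (\<Union>i\<in>?I. ?B i)"
    by (intro card_mono) (auto intro: finite_nonvanishing_box)
  also have "\<dots> \<le> (\<Sum>i\<in>?I. card (?B i))"
    by (rule card_UN_le) simp
  also have "\<dots> = (\<Sum>i\<in>?I - {(a, b)}. card (?B i))"
    using empty ab by (subst sum.remove[of _ "(a, b)"]) auto
  also have "\<dots> \<le> (\<Sum>i\<in>?I - {(a, b)}. 255 ^ j)"
    by (intro sum_mono) (auto intro: Suc.IH)
  also have "\<dots> = 255 ^ Suc j"
    using ab by (simp add: card_Diff_singleton)
  finally show ?case .
qed

text \<open>The strip is covered by T boxes of side \<open>16^j\<close>, stacked in the direction of
  N.\<close>

lemma sum_card_nonvanishing:
  "(\<Sum>k<16 ^ j. card {N. N < 16 ^ j * T \<and> \<not> vanishing thue_morse_series k (int N)}) \<le> T * 255 ^ j"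
proof -
  let ?V = "\<lambda>k. {N. N < 16 ^ j * T \<and> \<not> vanishing thue_morse_series k (int N)}"
  have "(\<Sum>k<16 ^ j. card (?V k)) = card (SIGMA k:{..<16 ^ j}. ?V k)"
    by (rule card_SigmaI[symmetric]) auto
  also have "\<dots> \<le> card (\<Union>t<T. nonvanishing_box j 0 t)"
  proof (intro card_mono subsetI)
    fix z assume "z \<in> (SIGMA k:{..<16 ^ j}. ?V k)"
    then obtain k N where z: "z = (k, N)" "k < 16 ^ j" "N < 16 ^ j * T" "\<not> vanishing thue_morse_series k (int N)"
      by auto
    have "N div 16 ^ j < T"
      using z(3) by (simp add: less_mult_imp_div_less mult.commute)
    moreover have "16 ^ j * (N div 16 ^ j) \<le> N" "N < 16 ^ j * (N div 16 ^ j) + 16 ^ j"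
      using dividend_less_times_div[of "16 ^ j" N] by (simp_all add: add.commute)
    ultimately show "z \<in> (\<Union>t<T. nonvanishing_box j 0 t)"
      using z by (intro UN_I[of "N div 16 ^ j"]) (simp_all add: nonvanishing_box_def algebra_simps)
  qed (auto intro: finite_nonvanishing_box)
  also have "\<dots> \<le> (\<Sum>t<T. card (nonvanishing_box j 0 t))"
    by (rule card_UN_le) simp
  also have "\<dots> \<le> (\<Sum>t<T. 255 ^ j)"
    by (intro sum_mono card_nonvanishing_box)
  finally show ?thesis by simp
qed

section \<open>Density of the exponents with slow escape\<close>

text \<open>Double counting: in a strip of height \<open>M = 16^j T\<close>, each \<open>k\<close>
  in \<open>B\<close> accounts for about \<open>\<eta> M\<close> nonvanishing points, while the
  strip contains at most \<open>T * 255^j\<close>. Letting T grow removes the error terms.\<close>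

lemma card_slow_escape:
  fixes \<eta> :: real
  assumes "\<eta> > 0"
  defines "B \<equiv> {k. \<eta> * real (tm_cf.mass k) \<le> real (cf_period (tvar ^ k * thue_morse_series))}"
  shows "real (card (B \<inter> {..<16 ^ j})) * \<eta> * 16 ^ j \<le> 255 ^ j"
proof -
  let ?x = "\<lambda>k. tvar ^ k * thue_morse_series"
  let ?V = "\<lambda>k M. {N. N < M \<and> \<not> vanishing thue_morse_series k (int N)}"
  \<comment> \<open>The loss from the preperiod and from one incomplete period; it does not depend
    on the height M.\<close>
  define E where "E k = real (convergent_degree (?x k) (cf_preperiod (?x k))) + real (tm_cf.mass k)" for k
  have lower: "\<eta> * (real M - E k) \<le> real (card (?V k M))" if "k \<in> B" for k M
  proof (cases "E k \<le> real M")
    case False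
    then have "\<eta> * (real M - E k) \<le> 0"
      using assms(1) by (intro mult_nonneg_nonpos) auto
    then show ?thesis
      by (rule order_trans) simp
  next
    case True
    have m: "real (tm_cf.mass k) > 0"
      using tm_cf.mass_pos[of k] by simp
    have "\<eta> \<le> real (cf_period (?x k)) / real (tm_cf.mass k)"
      using that m by (simp add: B_def le_divide_eq)
    then have "\<eta> * (real M - E k) \<le> real (cf_period (?x k)) / real (tm_cf.mass k) * (real M - E k)"
      using True by (intro mult_right_mono) auto
    also have "\<dots> = real (cf_period (?x k)) *
        ((real M - real (convergent_degree (?x k) (cf_preperiod (?x k)))) / real (tm_cf.mass k) - 1)"
      using m by (simp add: E_def field_simps)
    also have "\<dots> \<le> real (card (range (convergent_degree (?x k)) \<inter> {..<M}))"
      by (rule tm_cf.card_convergent_degrees)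
    also have "\<dots> \<le> real (card (?V k M))"
      by (intro of_nat_mono card_mono) (auto simp: convergent_degree_not_vanishing)
    finally show ?thesis .
  qed
  let ?S = "B \<inter> {..<16 ^ j}"
  have bound: "(real (card ?S) * \<eta> * 16 ^ j - 255 ^ j) * real T \<le> \<eta> * sum E ?S" for T
  proof -
    have "real (card ?S) * \<eta> * 16 ^ j * real T - \<eta> * sum E ?S = (\<Sum>k\<in>?S. \<eta> * (real (16 ^ j * T) - E k))"
      by (simp add: sum_distrib_left[symmetric] sum_subtractf right_diff_distrib)
    also have "\<dots> \<le> (\<Sum>k\<in>?S. real (card (?V k (16 ^ j * T))))"
      by (intro sum_mono lower) auto
    also have "\<dots> \<le> (\<Sum>k<16 ^ j. real (card (?V k (16 ^ j * T))))"
      by (intro sum_mono2) auto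
    also have "\<dots> \<le> real (T * 255 ^ j)"
      unfolding of_nat_sum[symmetric] of_nat_le_iff by (rule sum_card_nonvanishing)
    finally have "real (card ?S) * \<eta> * 16 ^ j * real T - \<eta> * sum E ?S \<le> real T * 255 ^ j"
      by (simp only: of_nat_mult of_nat_power of_nat_numeral)
    then show ?thesis
      by (simp add: left_diff_distrib mult.commute[of "real T"])
  qed
  show ?thesis
  proof (rule ccontr)
    assume "\<not> ?thesis"
    then have "0 < real (card ?S) * \<eta> * 16 ^ j - 255 ^ j"
      by linarith
    then obtain T where "\<eta> * sum E ?S < real T * (real (card ?S) * \<eta> * 16 ^ j - 255 ^ j)"
      using reals_Archimedean3 by blast
    with bound[of T] show False
      unfolding mult.commute[of "real T"] by linarith
  qed
qed

lemma slow_escape_density_0: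
  fixes \<eta> :: real
  assumes "\<eta> > 0"
  defines "B \<equiv> {k. \<eta> * real (tm_cf.mass k) \<le> real (cf_period (tvar ^ k * thue_morse_series))}"
  shows "has_density B 0"
  unfolding has_density_def
proof (rule LIMSEQ_I)
  fix r :: real assume "r > 0"
  then have "r * \<eta> / 16 > 0"
    using assms by simp
  \<comment> \<open>The divisor 16 compensates for replacing m by the next power of 16, which is at
    most \<open>16 m\<close>.\<close>
  then obtain J where J: "(255 / 256 :: real) ^ J < r * \<eta> / 16"
    using real_arch_pow_inv[of "r * \<eta> / 16" "255 / 256"] by auto
  have "norm (real (card (B \<inter> {1..m})) / real m - 0) < r" if m: "m \<ge> 16 ^ J" for m
  proof -
    have m1: "m \<ge> 1"
      using m by (metis one_le_power order_trans one_le_numeral)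
    then obtain j where j: "16 ^ j \<le> m" "m < 16 ^ (j + 1)"
      using ex_power_ivl1[of 16 m] by auto
    have "16 ^ J < (16 :: nat) ^ (j + 1)"
      using m j(2) by (rule order_le_less_trans)
    then have "J \<le> j + 1"
      by (metis less_imp_le_nat power_less_imp_less_exp one_less_numeral_iff semiring_norm(76))
    have "card (B \<inter> {1..m}) \<le> card (B \<inter> {..<16 ^ (j + 1)})"
      using j(2) by (intro card_mono) auto
    then have "real (card (B \<inter> {1..m})) * \<eta> * 16 ^ (j + 1) \<le> real (card (B \<inter> {..<16 ^ (j + 1)})) * \<eta> * 16 ^ (j + 1)"
      using assms(1) by (intro mult_right_mono) auto
    also have "\<dots> \<le> 255 ^ (j + 1)"
      unfolding B_def by (rule card_slow_escape[OF assms(1)])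
    \<comment> \<open>One factor \<open>16^(j+1)\<close> belongs to the range of k; the other
      cancels against the left side.\<close>
    also have "\<dots> = (255 / 256) ^ (j + 1) * (16 ^ (j + 1) * 16 ^ (j + 1))"
      by (simp only: power_mult_distrib[symmetric]) simp
    finally have "real (card (B \<inter> {1..m})) * \<eta> * 16 ^ (j + 1) \<le>
        ((255 / 256) ^ (j + 1) * 16 ^ (j + 1)) * 16 ^ (j + 1)"
      by (simp only: mult.assoc)
    then have "real (card (B \<inter> {1..m})) * \<eta> \<le> (255 / 256) ^ (j + 1) * 16 ^ (j + 1)"
      by (rule mult_right_le_imp_le) simp
    also have "\<dots> \<le> (255 / 256) ^ J * 16 ^ (j + 1)"
      using \<open>J \<le> j + 1\<close> by (intro mult_right_mono power_decreasing) auto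
    also have "\<dots> < r * \<eta> / 16 * 16 ^ (j + 1)"
      using J by (intro mult_strict_right_mono) auto
    also have "\<dots> = r * \<eta> * 16 ^ j"
      by simp
    also have "\<dots> \<le> r * \<eta> * real m"
    proof (rule mult_left_mono)
      show "16 ^ j \<le> real m"
        using j(1) by (metis of_nat_le_iff of_nat_numeral of_nat_power)
      show "0 \<le> r * \<eta>"
        using \<open>r > 0\<close> assms(1) by simp
    qed
    finally have "real (card (B \<inter> {1..m})) < r * real m"
      using assms(1) by (simp add: mult.assoc mult.left_commute[of _ \<eta>] mult.commute[of _ \<eta>])
    then show ?thesis
      using m1 by (simp add: divide_less_eq)
  qed
  then show "\<exists>no. \<forall>m\<ge>no. norm (real (card (B \<inter> {1..m})) / real m - 0) < r"
    by blast
qed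

lemma has_density_1_if_compl:
  assumes "has_density B 0" "- B \<subseteq> A"
  shows "has_density A 1"
  unfolding has_density_def
proof (rule tendsto_sandwich)
  show "(\<lambda>m. 1 - real (card (B \<inter> {1..m})) / real m) \<longlonglongrightarrow> 1"
    using tendsto_diff[OF tendsto_const assms(1)[unfolded has_density_def], of 1] by simp
  show "\<forall>\<^sub>F m in sequentially. 1 - real (card (B \<inter> {1..m})) / real m \<le> real (card (A \<inter> {1..m})) / real m"
    using eventually_ge_at_top[of 1]
  proof eventually_elim
    case (elim m)
    have "card {1..m} \<le> card ((A \<inter> {1..m}) \<union> (B \<inter> {1..m}))"
      using assms(2) by (intro card_mono) auto
    also have "\<dots> \<le> card (A \<inter> {1..m}) + card (B \<inter> {1..m})"
      by (rule card_Un_le)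
    finally have "real m \<le> real (card (A \<inter> {1..m})) + real (card (B \<inter> {1..m}))"
      by simp
    then have "(real m - real (card (B \<inter> {1..m}))) / real m \<le> real (card (A \<inter> {1..m})) / real m"
      by (intro divide_right_mono) auto
    then show ?case
      using elim by (simp add: diff_divide_distrib)
  qed
  show "\<forall>\<^sub>F m in sequentially. real (card (A \<inter> {1..m})) / real m \<le> 1"
  proof (rule always_eventually, rule allI)
    fix m
    have "card (A \<inter> {1..m}) \<le> card {1..m}"
      by (intro card_mono) auto
    then show "real (card (A \<inter> {1..m})) / real m \<le> 1"
      by (cases "m = 0") (simp_all add: divide_le_eq_1)
  qed
qed simp

theorem theorem1p31:
  fixes \<epsilon> :: real
  assumes "\<epsilon> > 0"
  shows "\<exists>\<delta> :: nat \<Rightarrow> real.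
           (\<forall>\<^sub>F n in sequentially.
              has_density {k. escape_ratio thue_morse_series k n > 1 - \<epsilon>} (\<delta> n))
           \<and> \<delta> \<longlonglongrightarrow> 1"
proof (intro exI conjI)
  \<comment> \<open>The density is already 1 for each positive n, so \<delta> is the constant
    1.\<close>
  show "\<forall>\<^sub>F n in sequentially.
      has_density {k. escape_ratio thue_morse_series k n > 1 - \<epsilon>} 1"
    using eventually_gt_at_top[of 0]
  proof eventually_elim
    case (elim n)
    \<comment> \<open>The threshold \<open>\<epsilon> / n\<close> makes the loss
      \<open>n * cf_period / mass\<close> smaller than \<epsilon> outside \<open>?B\<close>; it is
      positive because \<open>n > 0\<close>.\<close>
    let ?B = "{k. \<epsilon> / real n * real (tm_cf.mass k) \<le> real (cf_period (tvar ^ k * thue_morse_series))}"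
    show ?case
    proof (rule has_density_1_if_compl)
      show "has_density ?B 0"
        by (rule slow_escape_density_0) (use assms elim in simp)
      show "- ?B \<subseteq> {k. escape_ratio thue_morse_series k n > 1 - \<epsilon>}"
      proof
        fix k assume "k \<in> - ?B"
        then have "real (cf_period (tvar ^ k * thue_morse_series)) < \<epsilon> / real n * real (tm_cf.mass k)"
          by simp
        then have "real n * real (cf_period (tvar ^ k * thue_morse_series)) < real n * (\<epsilon> / real n * real (tm_cf.mass k))"
          using elim by (intro mult_strict_left_mono) auto
        also have "\<dots> = \<epsilon> * real (tm_cf.mass k)"
          using elim by simp
        finally have "real n * real (cf_period (tvar ^ k * thue_morse_series)) / real (tm_cf.mass k) < \<epsilon>"
          using tm_cf.mass_pos[of k] by (simp add: divide_less_eq)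
        moreover have "escape_ratio thue_morse_series k n \<ge>
            1 - real n * real (cf_period (tvar ^ k * thue_morse_series)) / real (tm_cf.mass k)"
          using tm_cf.escaped_mass_ge[of n k]
          by (simp only: escape_ratio_def Let_def mult.commute[of thue_morse_series])
        ultimately show "k \<in> {k. escape_ratio thue_morse_series k n > 1 - \<epsilon>}"
          by simp
      qed
    qed
  qed
qed simp

end
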